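(* Let $G$ be a finite group, let $N\unlhd G$ be a normal subgroup of $G$, and assume that all Sylow subgroups of $N$ are abelian. Assume that $G$ is solvable and is relative almost monomial with respect to $N$. Then $G$ is almost monomial.
   Context: All characters are complex characters of finite groups, and $\operatorname{Irr}(G)$ is the set of irreducible characters of $G$. A linear character is a character of degree $1$. For $H\leqslant G$, $\chi_H$ denotes restriction to $H$ and $\theta^G$ denotes induction from $H$ to $G$. For a character $\chi$ of $G$, $\operatorname{Cons}(\chi):=\{\phi\in\operatorname{Irr}(G):\langle\phi,\chi\rangle>0\}$ is its set of constituents. A finite group $G$ is called almost monomial if for any $\chi\neq\phi\in\operatorname{Irr}(G)$ there exist a subgroup $H\leqslant G$ and a linear character $\lambda$ of $H$ such that $\chi\in\operatorname{Cons}(\lambda^G)$ and $\phi\notin\operatorname{Cons}(\lambda^G)$. Let $N\unlhd G$. The group $G$ is called relative almost monomial with respect to $N$ if for any $\chi\neq\phi\in\operatorname{Irr}(G)$ there exist a subgroup $H$ with $N\subseteq H\leqslant G$ and $\psi\in\operatorname{Irr}(H)$ such that $\psi_N\in\operatorname{Irr}(N)$, $\chi\in\operatorname{Cons}(\psi^G)$ and $\phi\notin\operatorname{Cons}(\psi^G)$. *)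

theory Defs
  imports
    "HOL-Algebra.Algebra"
    "Jordan_Normal_Form.VS_Connect"
    "Jordan_Normal_Form.Conjugate"
begin

text \<open>
  A subgroup \<open>H\<close> of \<open>G\<close>, regarded as a group in its own right, is \<open>G\<lparr>carrier := H\<rparr>\<close>.
  Class functions on \<open>G\<close> are functions that are \<open>undefined\<close> outside \<open>carrier G\<close>, so that two
  characters of \<open>G\<close> are equal in HOL iff they agree on \<open>carrier G\<close>, and restriction of
  characters is \<^const>\<open>restrict\<close>.
\<close>

definition GL :: "nat \<Rightarrow> complex mat monoid" where
  "GL n = units_of (ring_mat TYPE(complex) n ())"

definition representation :: "('a, 'b) monoid_scheme \<Rightarrow> nat \<Rightarrow> ('a \<Rightarrow> complex mat) \<Rightarrow> bool" where
  "representation G n \<rho> \<longleftrightarrow> \<rho> \<in> hom G (GL n)"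

definition invariant_subspace ::
  "('a, 'b) monoid_scheme \<Rightarrow> nat \<Rightarrow> ('a \<Rightarrow> complex mat) \<Rightarrow> complex vec set \<Rightarrow> bool" where
  "invariant_subspace G n \<rho> W \<longleftrightarrow>
     VectorSpace.subspace class_ring W (module_vec TYPE(complex) n) \<and>
     (\<forall>g\<in>carrier G. \<forall>w\<in>W. \<rho> g *\<^sub>v w \<in> W)"

definition irreducible_representation ::
  "('a, 'b) monoid_scheme \<Rightarrow> nat \<Rightarrow> ('a \<Rightarrow> complex mat) \<Rightarrow> bool" where
  "irreducible_representation G n \<rho> \<longleftrightarrow>
     representation G n \<rho> \<and> n > 0 \<and>
     (\<forall>W. invariant_subspace G n \<rho> W \<longrightarrow> W = {0\<^sub>v n} \<or> W = carrier_vec n)"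

definition mat_trace :: "complex mat \<Rightarrow> complex" where
  "mat_trace A = (\<Sum>i<dim_row A. A $$ (i, i))"

definition char_of_rep :: "('a, 'b) monoid_scheme \<Rightarrow> ('a \<Rightarrow> complex mat) \<Rightarrow> 'a \<Rightarrow> complex" where
  "char_of_rep G \<rho> = (\<lambda>g\<in>carrier G. mat_trace (\<rho> g))"

definition is_character :: "('a, 'b) monoid_scheme \<Rightarrow> ('a \<Rightarrow> complex) \<Rightarrow> bool" where
  "is_character G \<chi> \<longleftrightarrow> (\<exists>n \<rho>. representation G n \<rho> \<and> \<chi> = char_of_rep G \<rho>)"

definition Irr :: "('a, 'b) monoid_scheme \<Rightarrow> ('a \<Rightarrow> complex) set" where
  "Irr G = {\<chi>. \<exists>n \<rho>. irreducible_representation G n \<rho> \<and> \<chi> = char_of_rep G \<rho>}"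

text \<open>The degree of a character is its value at the identity.\<close>

definition linear_character :: "('a, 'b) monoid_scheme \<Rightarrow> ('a \<Rightarrow> complex) \<Rightarrow> bool" where
  "linear_character G \<theta> \<longleftrightarrow> is_character G \<theta> \<and> \<theta> \<one>\<^bsub>G\<^esub> = 1"

definition char_inner ::
  "('a, 'b) monoid_scheme \<Rightarrow> ('a \<Rightarrow> complex) \<Rightarrow> ('a \<Rightarrow> complex) \<Rightarrow> complex" where
  "char_inner G \<phi> \<chi> = (\<Sum>g\<in>carrier G. \<phi> g * cnj (\<chi> g)) / of_nat (card (carrier G))"

text \<open>
  The order on \<^typ>\<open>complex\<close> is the one of \<^theory>\<open>HOL-Library.Complex_Order\<close>: \<open>0 < z\<close> means
  that \<open>z\<close> is real and positive.
\<close>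

definition constituents :: "('a, 'b) monoid_scheme \<Rightarrow> ('a \<Rightarrow> complex) \<Rightarrow> ('a \<Rightarrow> complex) set" where
  "constituents G \<chi> = {\<phi> \<in> Irr G. char_inner G \<phi> \<chi> > 0}"

definition induced ::
  "('a, 'b) monoid_scheme \<Rightarrow> 'a set \<Rightarrow> ('a \<Rightarrow> complex) \<Rightarrow> 'a \<Rightarrow> complex" where
  "induced G H \<theta> = (\<lambda>g\<in>carrier G.
     (\<Sum>x\<in>carrier G.
        if x \<otimes>\<^bsub>G\<^esub> g \<otimes>\<^bsub>G\<^esub> inv\<^bsub>G\<^esub> x \<in> H then \<theta> (x \<otimes>\<^bsub>G\<^esub> g \<otimes>\<^bsub>G\<^esub> inv\<^bsub>G\<^esub> x) else 0)
     / of_nat (card H))"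

definition almost_monomial :: "('a, 'b) monoid_scheme \<Rightarrow> bool" where
  "almost_monomial G \<longleftrightarrow>
     (\<forall>\<chi>\<in>Irr G. \<forall>\<phi>\<in>Irr G. \<chi> \<noteq> \<phi> \<longrightarrow>
        (\<exists>H \<theta>. subgroup H G \<and> linear_character (G\<lparr>carrier := H\<rparr>) \<theta> \<and>
           \<chi> \<in> constituents G (induced G H \<theta>) \<and> \<phi> \<notin> constituents G (induced G H \<theta>)))"

definition relative_almost_monomial :: "('a, 'b) monoid_scheme \<Rightarrow> 'a set \<Rightarrow> bool" where
  "relative_almost_monomial G N \<longleftrightarrow>
     (\<forall>\<chi>\<in>Irr G. \<forall>\<phi>\<in>Irr G. \<chi> \<noteq> \<phi> \<longrightarrow>
        (\<exists>H \<psi>. subgroup H G \<and> N \<subseteq> H \<and> \<psi> \<in> Irr (G\<lparr>carrier := H\<rparr>) \<and>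
           restrict \<psi> N \<in> Irr (G\<lparr>carrier := N\<rparr>) \<and>
           \<chi> \<in> constituents G (induced G H \<psi>) \<and> \<phi> \<notin> constituents G (induced G H \<psi>)))"

text \<open>For a prime \<open>p\<close> not dividing the order of \<open>G\<close> the Sylow \<open>p\<close>-subgroup is trivial.\<close>

definition sylow_subgroup :: "('a, 'b) monoid_scheme \<Rightarrow> nat \<Rightarrow> 'a set \<Rightarrow> bool" where
  "sylow_subgroup G p P \<longleftrightarrow>
     Factorial_Ring.prime p \<and> subgroup P G \<and> card P = p ^ multiplicity p (card (carrier G))"

end

theory Submission
  imports Defs "Jordan_Normal_Form.Spectral_Radius"
begin

text \<open>
  Let \<open>\<chi> \<noteq> \<phi>\<close> be irreducible characters of \<open>G\<close>, separated by \<open>\<psi>\<^sup>G\<close> for some \<open>\<psi> \<in> Irr H\<close> with \<open>N \<subseteq> H\<close> and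
  \<open>\<psi>\<close> irreducible on \<open>N\<close>. If \<open>\<psi>\<close> is induced from a linear character \<open>\<theta>\<close> of a subgroup \<open>U\<close> of \<open>H\<close>, then
  \<open>\<psi>\<^sup>G = \<theta>\<^sup>G\<close> because induction is transitive (\<open>induced_transitive\<close>), and \<open>(U, \<theta>)\<close> separates the
  same two characters. So everything rests on one fact: under the assumptions on \<open>G\<close> and \<open>N\<close>, an
  irreducible character of \<open>H\<close> that stays irreducible on \<open>N\<close> is monomial (\<open>irreducible_restriction_imp_monomial\<close>). The argument for it is Clifford theory,
  carried out with idempotent matrices in place of subspaces.

  Let \<open>\<rho>\<close> be a matrix representation with character \<open>\<psi>\<close>. A block idempotent is a nonzero idempotent \<open>e\<close>
  such that every \<open>\<rho> g\<close> either commutes with \<open>e\<close> or satisfies \<open>e * \<rho> g * e = 0\<close>; its stabilizer \<open>U\<close> consists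
  of the \<open>g\<close> of the first kind. The image of \<open>e\<close> is a block of a system of imprimitivity.
  Schur's lemma, applied to the sum of all conjugates of \<open>e\<close>, shows that \<open>\<psi>\<close> is induced from
  \<open>u \<mapsto> trace (e * \<rho> u)\<close> on \<open>U\<close> (\<open>trace_as_induced\<close>). Hence a block of rank one is all that is needed,
  and a block whose stabilizer has the least order will be shown to have rank one.

  Since \<open>\<psi>\<close> is irreducible on \<open>N\<close>, the matrices \<open>\<rho> x\<close> with \<open>x \<in> N\<close> span all matrices, and therefore
  \<open>M = N \<inter> U\<close> acts irreducibly on the image of \<open>e\<close> (\<open>block_compression\<close>, \<open>block_minimal\<close>).
  If \<open>A \<subseteq> M\<close> is normal in \<open>U\<close> and acts on that image through commuting matrices, then \<open>U\<close> permutes the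
  weight spaces of \<open>A\<close>, so the projection to one of them is again a block (\<open>weight_block\<close>); minimality
  forces it to equal \<open>e\<close>, that is, \<open>A\<close> acts by scalars (\<open>minimal_block_abelian_scalar\<close>).

  Let \<open>Z\<close> be the group of all elements of \<open>M\<close> that act by scalars on the image of \<open>e\<close>. If \<open>Z \<noteq> M\<close>,
  solvability provides a normal subgroup \<open>A \<subseteq> M\<close> of \<open>U\<close>, not contained in \<open>Z\<close>, that is an elementary
  abelian \<open>p\<close>-group modulo \<open>Z\<close> (\<open>exists_elementary_abelian_section\<close>). Modulo \<open>Z\<close> it is covered by a Sylow
  \<open>p\<close>-subgroup \<open>P\<close> of \<open>A\<close> (\<open>factor_through_sylow\<close>), and \<open>P\<close> is abelian because it is conjugate into a Sylow
  subgroup of \<open>N\<close> (\<open>p_subgroup_commutes\<close>). So \<open>A\<close> acts through commuting matrices, hence by scalars,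
  which contradicts the choice of \<open>A\<close>. Thus all of \<open>M\<close> acts by scalars; being irreducible as well,
  this action has degree one.
\<close>

section \<open>Finite sums of square matrices\<close>

definition mat_sum :: "nat \<Rightarrow> 'i set \<Rightarrow> ('i \<Rightarrow> complex mat) \<Rightarrow> complex mat" where
  "mat_sum n S f = mat n n (\<lambda>ij. \<Sum>s\<in>S. f s $$ ij)"

lemma mat_sum_carrier [simp]: "mat_sum n S f \<in> carrier_mat n n"
  by (simp add: mat_sum_def)

lemma mat_sum_index [simp]:
  "i < n \<Longrightarrow> j < n \<Longrightarrow> mat_sum n S f $$ (i, j) = (\<Sum>s\<in>S. f s $$ (i, j))"
  by (simp add: mat_sum_def)

lemma mat_sum_dim [simp]: "dim_row (mat_sum n S f) = n" "dim_col (mat_sum n S f) = n"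
  by (simp_all add: mat_sum_def)

lemma mat_sum_cong: "(\<And>s. s \<in> S \<Longrightarrow> f s = g s) \<Longrightarrow> mat_sum n S f = mat_sum n S g"
  by (simp add: mat_sum_def)

lemma mult_index:
  assumes "A \<in> carrier_mat n n" "B \<in> carrier_mat n n" "i < n" "j < n"
  shows "(A * B) $$ (i, j) = (\<Sum>k<n. A $$ (i, k) * B $$ (k, j))"
  using assms by (simp add: scalar_prod_def atLeast0LessThan)

lemma mat_sum_mult_left:
  assumes "A \<in> carrier_mat n n" "\<And>s. s \<in> S \<Longrightarrow> f s \<in> carrier_mat n n"
  shows "A * mat_sum n S f = mat_sum n S (\<lambda>s. A * f s)"
proof (rule eq_matI)
  fix i j assume "i < dim_row (mat_sum n S (\<lambda>s. A * f s))" "j < dim_col (mat_sum n S (\<lambda>s. A * f s))"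
  then have ij: "i < n" "j < n" by auto
  have "(A * mat_sum n S f) $$ (i, j) = (\<Sum>k<n. \<Sum>s\<in>S. A $$ (i, k) * f s $$ (k, j))"
    using assms ij by (simp add: mult_index[of _ n] sum_distrib_left del: index_mult_mat)
  also have "\<dots> = (\<Sum>s\<in>S. \<Sum>k<n. A $$ (i, k) * f s $$ (k, j))" by (rule sum.swap)
  finally show "(A * mat_sum n S f) $$ (i, j) = mat_sum n S (\<lambda>s. A * f s) $$ (i, j)"
    using assms ij by (simp add: mult_index[of _ n] del: index_mult_mat)
qed (use assms in auto)

lemma mat_sum_mult_right:
  assumes "A \<in> carrier_mat n n" "\<And>s. s \<in> S \<Longrightarrow> f s \<in> carrier_mat n n"
  shows "mat_sum n S f * A = mat_sum n S (\<lambda>s. f s * A)"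
proof (rule eq_matI)
  fix i j assume "i < dim_row (mat_sum n S (\<lambda>s. f s * A))" "j < dim_col (mat_sum n S (\<lambda>s. f s * A))"
  then have ij: "i < n" "j < n" by auto
  have "(mat_sum n S f * A) $$ (i, j) = (\<Sum>k<n. \<Sum>s\<in>S. f s $$ (i, k) * A $$ (k, j))"
    using assms ij by (simp add: mult_index[of _ n] sum_distrib_right del: index_mult_mat)
  also have "\<dots> = (\<Sum>s\<in>S. \<Sum>k<n. f s $$ (i, k) * A $$ (k, j))" by (rule sum.swap)
  finally show "(mat_sum n S f * A) $$ (i, j) = mat_sum n S (\<lambda>s. f s * A) $$ (i, j)"
    using assms ij by (simp add: mult_index[of _ n] del: index_mult_mat)
qed (use assms in auto)

lemma mat_sum_smult:
  assumes "\<And>s. s \<in> S \<Longrightarrow> f s \<in> carrier_mat n n"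
  shows "c \<cdot>\<^sub>m mat_sum n S f = mat_sum n S (\<lambda>s. c \<cdot>\<^sub>m f s)"
  by (rule eq_matI)
     (auto simp: sum_distrib_left carrier_matD[OF assms] intro!: sum.cong)

lemma smult_smult_mat: "c \<cdot>\<^sub>m (d \<cdot>\<^sub>m A) = (c * d) \<cdot>\<^sub>m A" for A :: "complex mat"
  by (rule eq_matI) auto

lemma one_smult_mat [simp]: "1 \<cdot>\<^sub>m A = A" for A :: "complex mat"
  by (rule eq_matI) auto

lemma zero_smult_mat: "A \<in> carrier_mat n n \<Longrightarrow> 0 \<cdot>\<^sub>m A = 0\<^sub>m n n" for A :: "complex mat"
  by (rule eq_matI) auto

lemma mat_sum_const:
  assumes "Y \<in> carrier_mat n n"
  shows "mat_sum n S (\<lambda>_. Y) = of_nat (card S) \<cdot>\<^sub>m Y"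
  by (rule eq_matI, insert assms) (auto simp: carrier_matD)

lemma mat_sum_scaled_const:
  assumes "Y \<in> carrier_mat n n"
  shows "mat_sum n S (\<lambda>s. c s \<cdot>\<^sub>m Y) = sum c S \<cdot>\<^sub>m Y"
  by (rule eq_matI, insert assms) (auto simp: carrier_matD sum_distrib_right)

lemma mat_sum_reindex:
  assumes "bij_betw \<pi> S T"
  shows "mat_sum n S (\<lambda>s. f (\<pi> s)) = mat_sum n T f"
  by (rule eq_matI) (auto simp: sum.reindex_bij_betw[OF assms, of "\<lambda>t. f t $$ (_, _)"])

lemma mat_sum_restrict:
  assumes "finite S" "T \<subseteq> S" "\<And>s. s \<in> S - T \<Longrightarrow> f s = 0\<^sub>m n n"
  shows "mat_sum n S f = mat_sum n T f"
  by (rule eq_matI) (auto intro!: sum.mono_neutral_right simp: assms subsetD[OF assms(2)])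

lemma mat_trace_sum:
  assumes "\<And>s. s \<in> S \<Longrightarrow> f s \<in> carrier_mat n n"
  shows "mat_trace (mat_sum n S f) = (\<Sum>s\<in>S. mat_trace (f s))"
proof -
  have "mat_trace (mat_sum n S f) = (\<Sum>i<n. \<Sum>s\<in>S. f s $$ (i, i))"
    by (simp add: mat_trace_def)
  also have "\<dots> = (\<Sum>s\<in>S. \<Sum>i<n. f s $$ (i, i))" by (rule sum.swap)
  also have "\<dots> = (\<Sum>s\<in>S. mat_trace (f s))"
    using assms by (intro sum.cong) (auto simp: mat_trace_def carrier_matD)
  finally show ?thesis .
qed

lemma mat_trace_comm:
  assumes "A \<in> carrier_mat n n" "B \<in> carrier_mat n n"
  shows "mat_trace (A * B) = mat_trace (B * A)"
proof -
  have "mat_trace (A * B) = (\<Sum>i<n. \<Sum>k<n. A $$ (i, k) * B $$ (k, i))"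
    using assms by (simp add: mat_trace_def mult_index[of _ n] del: index_mult_mat(1))
  also have "\<dots> = (\<Sum>k<n. \<Sum>i<n. B $$ (k, i) * A $$ (i, k))"
    by (subst sum.swap) (simp add: mult.commute)
  also have "\<dots> = mat_trace (B * A)"
    using assms by (simp add: mat_trace_def mult_index[of _ n] del: index_mult_mat(1))
  finally show ?thesis .
qed

lemma mat_trace_smult: "mat_trace (c \<cdot>\<^sub>m A) = c * mat_trace A" if "A \<in> carrier_mat n n"
  using that by (auto simp: mat_trace_def sum_distrib_left)

lemma mat_trace_one: "mat_trace (1\<^sub>m n) = of_nat n"
  by (simp add: mat_trace_def)

definition mat_unit :: "nat \<Rightarrow> nat \<Rightarrow> nat \<Rightarrow> complex mat" where
  "mat_unit n i j = mat n n (\<lambda>(a, b). if a = i \<and> b = j then 1 else 0)"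

lemma mat_unit_carrier [simp]: "mat_unit n i j \<in> carrier_mat n n"
  by (simp add: mat_unit_def)

text \<open>
  Sandwiching a matrix unit isolates products of single entries. This is how matrix identities that
  hold for all \<open>Y\<close> are turned into statements about entries.
\<close>
lemma mult_mat_unit_mult_index:
  assumes A: "A \<in> carrier_mat n n" and B: "B \<in> carrier_mat n n"
    and "i < n" "j < n" "a < n" "b < n"
  shows "(A * mat_unit n i j * B) $$ (a, b) = A $$ (a, i) * B $$ (j, b)"
proof -
  have 1: "(A * mat_unit n i j) $$ (a, k) = (if k = j then A $$ (a, i) else 0)" if "k < n" for k
  proof -
    have "(A * mat_unit n i j) $$ (a, k) = (\<Sum>l<n. A $$ (a, l) * (if l = i \<and> k = j then 1 else 0))"
      using assms that by (subst mult_index[of _ n]) (auto simp: mat_unit_def)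
    also have "\<dots> = (\<Sum>l<n. if l = i then (if k = j then A $$ (a, i) else 0) else 0)"
      by (intro sum.cong) auto
    finally show ?thesis using assms by simp
  qed
  have "(A * mat_unit n i j * B) $$ (a, b) = (\<Sum>k<n. (A * mat_unit n i j) $$ (a, k) * B $$ (k, b))"
    using assms by (intro mult_index[of _ n]) auto
  also have "\<dots> = (\<Sum>k<n. if k = j then A $$ (a, i) * B $$ (k, b) else 0)"
    using 1 by (intro sum.cong) auto
  finally show ?thesis using assms by simp
qed

lemma mat_trace_mat_unit: "i < n \<Longrightarrow> j < n \<Longrightarrow> mat_trace (mat_unit n i j) = (if i = j then 1 else 0)"
proof -
  assume "i < n" "j < n"
  have "mat_trace (mat_unit n i j) = (\<Sum>k<n. if k = i then (if i = j then 1 else 0) else 0)"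
    unfolding mat_trace_def mat_unit_def by (intro sum.cong) auto
  then show ?thesis using \<open>i < n\<close> by simp
qed


lemma nonzero_entry:
  fixes A :: "complex mat"
  assumes "A \<in> carrier_mat n n" "A \<noteq> 0\<^sub>m n n"
  obtains i j where "i < n" "j < n" "A $$ (i, j) \<noteq> 0"
proof -
  have "\<exists>i<n. \<exists>j<n. A $$ (i, j) \<noteq> 0"
  proof (rule ccontr)
    assume "\<not> ?thesis"
    then have "A = 0\<^sub>m n n" using assms(1) by (intro eq_matI) auto
    then show False using assms(2) by simp
  qed
  then show thesis using that by blast
qed

lemma smult_mat_cancel:
  fixes q :: "complex mat"
  assumes "c \<cdot>\<^sub>m q = d \<cdot>\<^sub>m q" "q \<in> carrier_mat n n" "q \<noteq> 0\<^sub>m n n"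
  shows "c = d"
proof -
  obtain i j where ij: "i < n" "j < n" "q $$ (i, j) \<noteq> 0" using nonzero_entry[OF assms(2,3)] .
  have "(c \<cdot>\<^sub>m q) $$ (i, j) = (d \<cdot>\<^sub>m q) $$ (i, j)" by (simp only: assms(1))
  then show ?thesis using ij assms(2) by simp
qed

lemma kernel_subspace:
  assumes "A \<in> carrier_mat m n"
  shows "VectorSpace.subspace class_ring {v \<in> carrier_vec n. A *\<^sub>v v = 0\<^sub>v m} (module_vec TYPE(complex) n)"
proof (unfold VectorSpace.subspace_def, intro conjI)
  show "vectorspace class_ring (module_vec TYPE(complex) n)" by (rule vec_vs)
  show "submodule class_ring {v \<in> carrier_vec n. A *\<^sub>v v = 0\<^sub>v m} (module_vec TYPE(complex) n)"
    using assms vec_module[of n]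
    by (intro submodule.intro)
       (auto simp: module_vec_simps mult_add_distrib_mat_vec[OF assms] mult_mat_vec[OF assms])
qed

lemma mult_mat_vec_zero: "A \<in> carrier_mat m n \<Longrightarrow> A *\<^sub>v 0\<^sub>v n = 0\<^sub>v m" for A :: "complex mat"
  by (intro eq_vecI) (auto simp: scalar_prod_def)

lemma zero_mat_if_zero_map:
  fixes A :: "complex mat"
  assumes A: "A \<in> carrier_mat n n" and zero: "\<And>v. v \<in> carrier_vec n \<Longrightarrow> A *\<^sub>v v = 0\<^sub>v n"
  shows "A = 0\<^sub>m n n"
proof -
  have "A $$ (i, j) = 0" if "i < n" "j < n" for i j
  proof -
    have "(A *\<^sub>v unit_vec n j) $ i = 0" using that zero[of "unit_vec n j"] by simp
    then show ?thesis using A that by (simp add: row_def)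
  qed
  then show ?thesis using A by (intro eq_matI) auto
qed

section \<open>Schur's lemma and the orthogonality relations\<close>

locale matrix_representation = group G for G :: "('a, 'b) monoid_scheme" (structure) +
  fixes n :: nat and \<rho> :: "'a \<Rightarrow> complex mat"
  assumes finite_carrier: "finite (carrier G)"
    and representation: "representation G n \<rho>"
begin

lemma rho_unit: "g \<in> carrier G \<Longrightarrow> \<rho> g \<in> Units (ring_mat TYPE(complex) n ())"
  using representation by (auto simp: representation_def GL_def hom_def units_of_def)

lemma rho_carrier [simp]: "g \<in> carrier G \<Longrightarrow> \<rho> g \<in> carrier_mat n n"
  using rho_unit by (auto simp: Units_def ring_mat_simps)

lemma rho_mult: "g \<in> carrier G \<Longrightarrow> h \<in> carrier G \<Longrightarrow> \<rho> (g \<otimes> h) = \<rho> g * \<rho> h"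
  using representation by (auto simp: representation_def GL_def hom_def units_of_def ring_mat_simps)

lemma rho_one: "\<rho> \<one> = 1\<^sub>m n"
proof -
  interpret R: ring "ring_mat TYPE(complex) n ()" by (rule ring_mat)
  have "group_hom G (GL n) \<rho>"
    using representation R.units_group
    by (simp add: group_hom_def group_hom_axioms_def representation_def GL_def is_group)
  then show ?thesis
    using group_hom.hom_one by (force simp: GL_def units_of_def ring_mat_simps)
qed

lemma rho_inv:
  assumes "g \<in> carrier G"
  shows "\<rho> g * \<rho> (inv g) = 1\<^sub>m n" "\<rho> (inv g) * \<rho> g = 1\<^sub>m n"
  using assms by (simp_all flip: rho_mult add: rho_one)

end

text \<open>
  Over the complex numbers this is equivalent to irreducibility. It is the more convenient form,
  since conjugation by an invertible intertwiner visibly preserves it.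
\<close>
definition scalar_commutant :: "('a, 'b) monoid_scheme \<Rightarrow> nat \<Rightarrow> ('a \<Rightarrow> complex mat) \<Rightarrow> bool" where
  "scalar_commutant G n \<rho> \<longleftrightarrow> n > 0 \<and>
     (\<forall>C\<in>carrier_mat n n. (\<forall>g\<in>carrier G. C * \<rho> g = \<rho> g * C) \<longrightarrow> (\<exists>c. C = c \<cdot>\<^sub>m 1\<^sub>m n))"

lemma (in group) bij_betw_mult_left:
  assumes "g \<in> carrier G"
  shows "bij_betw (\<lambda>x. g \<otimes> x) (carrier G) (carrier G)"
  by (rule bij_betw_byWitness[of _ "\<lambda>x. inv g \<otimes> x"])
     (use assms in \<open>auto simp flip: m_assoc\<close>)

context matrix_representation begin

text \<open>
  Matrix products are reassociated in both directions below, so the default rule is switched off;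
  the square instances have no free dimension left and can be discharged by the simplifier.
\<close>
declare assoc_mult_mat [simp del] mult_carrier_mat [of _ n n _ n, simp]
  left_mult_one_mat [of _ n n, simp] right_mult_one_mat [of _ n n, simp]

text \<open>
  An eigenspace of a matrix that commutes with the representation is an invariant subspace.
\<close>
lemma irreducible_imp_scalar_commutant:
  assumes irr: "irreducible_representation G n \<rho>"
  shows "scalar_commutant G n \<rho>"
  unfolding scalar_commutant_def
proof (intro conjI ballI impI)
  show n: "n > 0" using irr by (simp add: irreducible_representation_def)
  fix C assume C: "C \<in> carrier_mat n n" and comm: "\<forall>g\<in>carrier G. C * \<rho> g = \<rho> g * C"
  obtain k v where v: "eigenvector C v k"
    using spectrum_non_empty[OF C n] by (auto simp: spectrum_def eigenvalue_def)
  define A where "A = char_matrix C k"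
  define W where "W = {w \<in> carrier_vec n. A *\<^sub>v w = 0\<^sub>v n}"
  have A: "A \<in> carrier_mat n n" using C by (simp add: A_def char_matrix_def)
  have "A * \<rho> g = \<rho> g * A" if "g \<in> carrier G" for g
    using that comm C unfolding A_def char_matrix_def
    by (simp add: add_mult_distrib_mat[of _ n n _ _ n] mult_add_distrib_mat[of _ n n _ n]
          mult_smult_distrib[of _ n n _ n] mult_smult_assoc_mat[of _ n n _ n] right_mult_one_mat[of _ n n] left_mult_one_mat[of _ n n])
  moreover have "\<rho> g *\<^sub>v 0\<^sub>v n = 0\<^sub>v n" if "g \<in> carrier G" for g
    using that by (simp add: mult_mat_vec_zero[of _ n])
  ultimately have "A *\<^sub>v (\<rho> g *\<^sub>v w) = 0\<^sub>v n" if "g \<in> carrier G" "w \<in> W" for g w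
    using that A assoc_mult_mat_vec[of A n n "\<rho> g" n w] assoc_mult_mat_vec[of "\<rho> g" n n A n w]
    by (simp add: W_def)
  then have "invariant_subspace G n \<rho> W"
    using kernel_subspace[OF A] by (auto simp: invariant_subspace_def W_def intro!: mult_mat_vec_carrier[of _ n n])
  moreover have "W \<noteq> {0\<^sub>v n}"
    using v C unfolding eigenvector_char_matrix[OF C] W_def A_def by blast
  ultimately have W: "W = carrier_vec n" using irr by (auto simp: irreducible_representation_def)
  have "A = 0\<^sub>m n n" using zero_mat_if_zero_map[OF A] W by (auto simp: W_def)
  then have "A $$ (i, j) = 0" if "i < n" "j < n" for i j using that by simp
  then have "C = k \<cdot>\<^sub>m 1\<^sub>m n"
    using C by (intro eq_matI) (fastforce simp: A_def char_matrix_def)+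
  then show "\<exists>c. C = c \<cdot>\<^sub>m 1\<^sub>m n" by blast
qed

text \<open>
  Averaging turns an arbitrary matrix into an intertwiner. It is applied both to a single
  representation, where Schur's lemma makes the average scalar, and to two representations
  with the same character.
\<close>
lemma average_intertwines:
  assumes \<sigma>: "matrix_representation G n \<sigma>" and Y: "Y \<in> carrier_mat n n" and g: "g \<in> carrier G"
  defines "T \<equiv> mat_sum n (carrier G) (\<lambda>x. \<rho> x * Y * \<sigma> (inv x))"
  shows "T * \<sigma> g = \<rho> g * T"
proof -
  interpret \<sigma>: matrix_representation G n \<sigma> by (rule \<sigma>)
  have summand: "\<rho> g * (\<rho> x * Y * \<sigma> (inv x)) = \<rho> (g \<otimes> x) * Y * \<sigma> (inv (g \<otimes> x)) * \<sigma> g"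
    if x: "x \<in> carrier G" for x
  proof -
    have "\<sigma> (inv (g \<otimes> x)) * \<sigma> g = \<sigma> (inv x)"
      using x g by (simp add: inv_mult_group m_assoc flip: \<sigma>.rho_mult)
    then show ?thesis
      using x g Y by (simp add: rho_mult assoc_mult_mat[of _ n n _ n _ n])
  qed
  have "\<rho> g * T = mat_sum n (carrier G) (\<lambda>x. \<rho> (g \<otimes> x) * Y * \<sigma> (inv (g \<otimes> x)) * \<sigma> g)"
    using g Y unfolding T_def
    by (subst mat_sum_mult_left) (auto simp: summand intro!: mat_sum_cong mult_carrier_mat)
  also have "\<dots> = mat_sum n (carrier G) (\<lambda>x. \<rho> x * Y * \<sigma> (inv x) * \<sigma> g)"
    using mat_sum_reindex[OF bij_betw_mult_left[OF g]] .
  also have "\<dots> = T * \<sigma> g"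
    using g Y unfolding T_def by (subst mat_sum_mult_right) auto
  finally show ?thesis by simp
qed

text \<open>
  The scalar is found by comparing traces.
\<close>
lemma conjugation_average_scalar:
  assumes sc: "scalar_commutant G n \<rho>" and Y: "Y \<in> carrier_mat n n"
  shows "mat_sum n (carrier G) (\<lambda>x. \<rho> x * Y * \<rho> (inv x))
           = (of_nat (card (carrier G)) * mat_trace Y / of_nat n) \<cdot>\<^sub>m 1\<^sub>m n"
proof -
  let ?C = "mat_sum n (carrier G) (\<lambda>x. \<rho> x * Y * \<rho> (inv x))"
  obtain c where c: "?C = c \<cdot>\<^sub>m 1\<^sub>m n"
    using sc average_intertwines[OF matrix_representation_axioms Y] unfolding scalar_commutant_def
    by (meson mat_sum_carrier)
  have "c * of_nat n = mat_trace ?C"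
    unfolding c by (simp add: mat_trace_smult[of _ n] mat_trace_one)
  also have "\<dots> = (\<Sum>x\<in>carrier G. mat_trace (\<rho> x * Y * \<rho> (inv x)))"
    using Y by (intro mat_trace_sum) auto
  also have "\<dots> = (\<Sum>x\<in>carrier G. mat_trace Y)"
  proof (rule sum.cong)
    fix x assume x: "x \<in> carrier G"
    have "mat_trace (\<rho> x * Y * \<rho> (inv x)) = mat_trace (\<rho> (inv x) * (\<rho> x * Y))"
      using x Y by (intro mat_trace_comm[of _ n]) auto
    also have "\<rho> (inv x) * (\<rho> x * Y) = Y"
      using x Y by (simp add: rho_inv flip: assoc_mult_mat[of _ n n _ n _ n])
    finally show "mat_trace (\<rho> x * Y * \<rho> (inv x)) = mat_trace Y" .
  qed simp
  finally have "c = of_nat (card (carrier G)) * mat_trace Y / of_nat n"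
    using sc by (simp add: scalar_commutant_def field_simps)
  then show ?thesis using c by simp
qed

lemma schur_orthogonality:
  assumes sc: "scalar_commutant G n \<rho>" and "i < n" "j < n" "k < n" "l < n"
  shows "(\<Sum>x\<in>carrier G. \<rho> x $$ (i, j) * \<rho> (inv x) $$ (k, l))
           = (if j = k \<and> i = l then of_nat (card (carrier G)) / of_nat n else 0)"
proof -
  have "(\<Sum>x\<in>carrier G. \<rho> x $$ (i, j) * \<rho> (inv x) $$ (k, l))
      = mat_sum n (carrier G) (\<lambda>x. \<rho> x * mat_unit n j k * \<rho> (inv x)) $$ (i, l)"
    using assms by (simp add: mult_mat_unit_mult_index del: index_mult_mat)
  also have "\<dots> = (if j = k \<and> i = l then of_nat (card (carrier G)) / of_nat n else 0)"
    using assms by (simp add: conjugation_average_scalar[OF sc] mat_trace_mat_unit)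
  finally show ?thesis .
qed

text \<open>
  Burnside's theorem, with the coefficients given by Fourier inversion: by orthogonality, the
  coefficient of \<open>\<rho> x\<close> in \<open>Y\<close> is a multiple of the trace of \<open>Y * \<rho> (inv x)\<close>.
\<close>
lemma scalar_commutant_imp_spanning:
  assumes sc: "scalar_commutant G n \<rho>" and Y: "Y \<in> carrier_mat n n"
  obtains c where "Y = mat_sum n (carrier G) (\<lambda>x. c x \<cdot>\<^sub>m \<rho> x)"
proof
  let ?c = "\<lambda>x. of_nat n / of_nat (card (carrier G)) * mat_trace (Y * \<rho> (inv x))"
  have n: "n > 0" using sc by (simp add: scalar_commutant_def)
  have cG: "card (carrier G) \<noteq> 0" using finite_carrier by auto
  show "Y = mat_sum n (carrier G) (\<lambda>x. ?c x \<cdot>\<^sub>m \<rho> x)"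
  proof (rule eq_matI)
    fix i j assume "i < dim_row (mat_sum n (carrier G) (\<lambda>x. ?c x \<cdot>\<^sub>m \<rho> x))"
      and "j < dim_col (mat_sum n (carrier G) (\<lambda>x. ?c x \<cdot>\<^sub>m \<rho> x))"
    then have ij: "i < n" "j < n" by auto
    have tr: "mat_trace (Y * \<rho> (inv x)) = (\<Sum>a<n. \<Sum>b<n. Y $$ (a, b) * \<rho> (inv x) $$ (b, a))"
      if "x \<in> carrier G" for x
      using that Y by (simp add: mat_trace_def mult_index[of _ n] del: index_mult_mat(1))
    have "mat_sum n (carrier G) (\<lambda>x. ?c x \<cdot>\<^sub>m \<rho> x) $$ (i, j)
        = (\<Sum>x\<in>carrier G. of_nat n / of_nat (card (carrier G)) *
            (\<Sum>a<n. \<Sum>b<n. Y $$ (a, b) * (\<rho> x $$ (i, j) * \<rho> (inv x) $$ (b, a))))"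
      using ij
      by (auto intro!: sum.cong simp: carrier_matD[OF rho_carrier] tr sum_distrib_left sum_distrib_right sum_divide_distrib mult_ac)
    also have "\<dots> = of_nat n / of_nat (card (carrier G)) *
            (\<Sum>a<n. \<Sum>b<n. \<Sum>x\<in>carrier G. Y $$ (a, b) * (\<rho> x $$ (i, j) * \<rho> (inv x) $$ (b, a)))"
      by (subst sum_distrib_left[symmetric], rule arg_cong[where f = "(*) _"],
          subst sum.swap, rule sum.cong[OF refl], rule sum.swap)
    also have "\<dots> = of_nat n / of_nat (card (carrier G)) *
            (\<Sum>a<n. \<Sum>b<n. if b = j then if a = i then Y $$ (a, b) * (of_nat (card (carrier G)) / of_nat n) else 0 else 0)"
      using ij
      by (intro arg_cong[where f = "(*) _"] sum.cong refl, subst sum_distrib_left[symmetric])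
         (auto simp: schur_orthogonality[OF sc])
    also have "\<dots> = Y $$ (i, j)"
      using ij n cG by simp
    finally show "Y $$ (i, j) = mat_sum n (carrier G) (\<lambda>x. ?c x \<cdot>\<^sub>m \<rho> x) $$ (i, j)" by simp
  qed (use Y in auto)
qed

lemma character_norm:
  assumes sc: "scalar_commutant G n \<rho>"
  shows "(\<Sum>x\<in>carrier G. mat_trace (\<rho> x) * mat_trace (\<rho> (inv x))) = of_nat (card (carrier G))"
proof -
  have "(\<Sum>x\<in>carrier G. mat_trace (\<rho> x) * mat_trace (\<rho> (inv x)))
      = (\<Sum>x\<in>carrier G. \<Sum>i<n. \<Sum>k<n. \<rho> x $$ (i, i) * \<rho> (inv x) $$ (k, k))"
    by (intro sum.cong) (auto simp: mat_trace_def sum_product carrier_matD[OF rho_carrier])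
  also have "\<dots> = (\<Sum>i<n. \<Sum>k<n. \<Sum>x\<in>carrier G. \<rho> x $$ (i, i) * \<rho> (inv x) $$ (k, k))"
    by (subst sum.swap, rule sum.cong[OF refl], rule sum.swap)
  also have "\<dots> = (\<Sum>i<n. \<Sum>k<n. if k = i then of_nat (card (carrier G)) / of_nat n else 0)"
    by (intro sum.cong refl) (auto simp: schur_orthogonality[OF sc])
  finally show ?thesis using sc by (simp add: scalar_commutant_def)
qed

text \<open>
  That the restriction of a character is irreducible says only that some representation with
  this character is irreducible. Orthogonality provides a nonzero intertwiner from that
  representation to the given one; its kernel is invariant, hence zero, so it is invertible and
  carries the commutant of one representation onto that of the other.
\<close>
lemma same_character_imp_scalar_commutant:
  assumes \<sigma>: "matrix_representation G m \<sigma>" and irr: "irreducible_representation G m \<sigma>"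
    and char: "\<And>g. g \<in> carrier G \<Longrightarrow> mat_trace (\<rho> g) = mat_trace (\<sigma> g)"
  shows "scalar_commutant G n \<rho>"
proof -
  interpret \<sigma>: matrix_representation G m \<sigma> by (rule \<sigma>)
  have sc: "scalar_commutant G m \<sigma>" by (rule \<sigma>.irreducible_imp_scalar_commutant[OF irr])
  have "mat_trace (1\<^sub>m n) = mat_trace (1\<^sub>m m)"
    using char[OF one_closed] by (simp add: rho_one \<sigma>.rho_one)
  then have m: "m = n" by (simp add: mat_trace_one)
  note sc = sc[unfolded m] and irr = irr[unfolded m] and \<sigma> = \<sigma>[unfolded m]
  have \<sigma>_carrier [simp]: "\<sigma> g \<in> carrier_mat n n" if "g \<in> carrier G" for g
    using that \<sigma>.rho_carrier m by simp
  define T where "T Y = mat_sum n (carrier G) (\<lambda>x. \<rho> x * Y * \<sigma> (inv x))" for Y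
  have T [simp]: "T Y \<in> carrier_mat n n" for Y by (simp add: T_def)
  have inter: "T Y * \<sigma> g = \<rho> g * T Y" if "Y \<in> carrier_mat n n" "g \<in> carrier G" for Y g
    using average_intertwines[OF \<sigma> that] by (simp add: T_def)
  \<comment> \<open>If every averaged intertwiner vanished, the two characters would be orthogonal.\<close>
  have "\<exists>Y\<in>carrier_mat n n. T Y \<noteq> 0\<^sub>m n n"
  proof (rule ccontr)
    assume "\<not> ?thesis"
    then have zero: "T (mat_unit n i k) = 0\<^sub>m n n" for i k by auto
    have entry: "(\<Sum>x\<in>carrier G. \<rho> x $$ (i, i) * \<sigma> (inv x) $$ (k, k)) = 0" if "i < n" "k < n" for i k
    proof -
      have "(\<Sum>x\<in>carrier G. \<rho> x $$ (i, i) * \<sigma> (inv x) $$ (k, k)) = T (mat_unit n i k) $$ (i, k)"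
        using that by (simp add: T_def mult_mat_unit_mult_index del: index_mult_mat)
      then show ?thesis using that by (simp add: zero)
    qed
    have "of_nat (card (carrier G))
        = (\<Sum>x\<in>carrier G. mat_trace (\<rho> x) * mat_trace (\<sigma> (inv x)))"
      using \<sigma>.character_norm sc m char by simp
    also have "\<dots> = (\<Sum>x\<in>carrier G. \<Sum>i<n. \<Sum>k<n. \<rho> x $$ (i, i) * \<sigma> (inv x) $$ (k, k))"
      by (intro sum.cong) (auto simp: mat_trace_def sum_product carrier_matD[OF rho_carrier] carrier_matD[OF \<sigma>_carrier])
    also have "\<dots> = (\<Sum>i<n. \<Sum>k<n. \<Sum>x\<in>carrier G. \<rho> x $$ (i, i) * \<sigma> (inv x) $$ (k, k))"
      by (subst sum.swap, rule sum.cong[OF refl], rule sum.swap)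
    also have "\<dots> = 0" by (simp add: entry)
    finally show False using finite_carrier by auto
  qed
  then obtain Y where Y: "Y \<in> carrier_mat n n" "T Y \<noteq> 0\<^sub>m n n" by blast
  define W where "W = {v \<in> carrier_vec n. T Y *\<^sub>v v = 0\<^sub>v n}"
  have "T Y *\<^sub>v (\<sigma> g *\<^sub>v v) = 0\<^sub>v n" if g: "g \<in> carrier G" and v: "v \<in> W" for g v
  proof -
    have "T Y *\<^sub>v (\<sigma> g *\<^sub>v v) = (T Y * \<sigma> g) *\<^sub>v v"
      using g v by (simp add: W_def assoc_mult_mat_vec[of _ n n _ n])
    also have "\<dots> = \<rho> g *\<^sub>v (T Y *\<^sub>v v)"
      using g v Y by (simp add: W_def inter assoc_mult_mat_vec[of _ n n _ n])
    also have "\<dots> = 0\<^sub>v n"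
      using g v by (simp add: W_def mult_mat_vec_zero[of _ n])
    finally show ?thesis .
  qed
  then have "invariant_subspace G n \<sigma> W"
    using kernel_subspace[OF T] by (auto simp: invariant_subspace_def W_def intro!: mult_mat_vec_carrier[of _ n n])
  then have "W = {0\<^sub>v n} \<or> W = carrier_vec n"
    using irr by (auto simp: irreducible_representation_def)
  moreover have "W \<noteq> carrier_vec n"
  proof
    assume W: "W = carrier_vec n"
    have "T Y = 0\<^sub>m n n" using zero_mat_if_zero_map[OF T] W by (auto simp: W_def)
    then show False using Y by simp
  qed
  ultimately have "W = {0\<^sub>v n}" by blast
  \<comment> \<open>An injective square matrix is invertible.\<close>
  then have "det (T Y) \<noteq> 0"
    by (auto simp: det_0_iff_vec_prod_zero[OF T] W_def)
  then obtain S where S [simp]: "S \<in> carrier_mat n n" and inverse: "S * T Y = 1\<^sub>m n" "T Y * S = 1\<^sub>m n"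
    using det_non_zero_imp_unit[OF T] by (auto simp: Units_def ring_mat_simps)
  show ?thesis
    unfolding scalar_commutant_def
  proof (intro conjI ballI impI)
    show "n > 0" using sc by (simp add: scalar_commutant_def)
    fix C assume C: "C \<in> carrier_mat n n" and comm: "\<forall>g\<in>carrier G. C * \<rho> g = \<rho> g * C"
    have "(S * C * T Y) * \<sigma> g = \<sigma> g * (S * C * T Y)" if g: "g \<in> carrier G" for g
    proof -
      have "(S * C * T Y) * \<sigma> g = S * (C * (T Y * \<sigma> g))"
        using g C by (simp add: assoc_mult_mat[of _ n n _ n _ n])
      also have "\<dots> = S * (C * \<rho> g * T Y)"
        using g C Y by (simp add: assoc_mult_mat[of _ n n _ n _ n] inter)
      also have "\<dots> = S * (\<rho> g * (T Y * S) * C * T Y)"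
        using g C comm by (simp add: inverse right_mult_one_mat[of _ n n])
      also have "\<dots> = S * ((\<rho> g * T Y) * (S * C * T Y))"
        using g C by (simp add: assoc_mult_mat[of _ n n _ n _ n])
      also have "\<dots> = (S * T Y) * \<sigma> g * (S * C * T Y)"
        using g C Y by (simp add: assoc_mult_mat[of _ n n _ n _ n] flip: inter)
      finally show ?thesis unfolding inverse(1) left_mult_one_mat[OF \<sigma>_carrier[OF g]] .
    qed
    then obtain c where c: "S * C * T Y = c \<cdot>\<^sub>m 1\<^sub>m n"
      using sc C unfolding scalar_commutant_def by (meson S T mult_carrier_mat)
    have "C = (T Y * S) * C * (T Y * S)" using C by (simp add: inverse)
    also have "\<dots> = T Y * (S * C * T Y) * S"
      using C by (simp add: assoc_mult_mat[of _ n n _ n _ n])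
    also have "\<dots> = c \<cdot>\<^sub>m 1\<^sub>m n"
      by (simp add: c inverse mult_smult_distrib[of _ n n _ n] mult_smult_assoc_mat[of _ n n _ n])
    finally show "\<exists>c. C = c \<cdot>\<^sub>m 1\<^sub>m n" by blast
  qed
qed

end

section \<open>Abelian Sylow subgroups\<close>

text \<open>
  All orbits have \<open>p\<close>-power length; if none had length one, \<open>p\<close> would divide the size of the set.
\<close>
lemma p_group_action_fixed_point:
  assumes act: "group_action G E \<phi>" and "finite E"
    and p: "Factorial_Ring.prime p" and order: "card (carrier G) = p ^ k" and ndvd: "\<not> p dvd card E"
  obtains x where "x \<in> E" "\<And>g. g \<in> carrier G \<Longrightarrow> \<phi> g x = x"
proof -
  interpret group_action G E \<phi> by (rule act)
  have "card E = (\<Sum>orb\<in>orbits G E \<phi>. card orb)"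
    using disjoint_sum[OF \<open>finite E\<close>, of "\<lambda>_. 1 :: nat"] by simp
  then have "\<exists>orb\<in>orbits G E \<phi>. \<not> p dvd card orb"
    using ndvd dvd_sum[of "orbits G E \<phi>" p card] by auto
  then obtain x where x: "x \<in> E" "\<not> p dvd card (orbit G \<phi> x)"
    unfolding orbits_def by blast
  have "card (orbit G \<phi> x) dvd p ^ k"
    using orbit_stabilizer_theorem[OF x(1)] order unfolding Coset.order_def by (metis dvd_triv_left)
  then obtain j where "card (orbit G \<phi> x) = p ^ j"
    using p divides_primepow_nat by blast
  then have "card (orbit G \<phi> x) = 1"
    using x(2) by (cases j) auto
  then obtain y where y: "orbit G \<phi> x = {y}" by (auto simp: card_1_singleton_iff)
  have "\<phi> g x = y" if "g \<in> carrier G" for g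
    using y that by (auto simp: orbit_def)
  moreover have "x \<in> orbit G \<phi> x"
    using orbit_refl x(1) by blast
  ultimately have "\<phi> g x = x" if "g \<in> carrier G" for g
    using y that by auto
  then show thesis using that x(1) by blast
qed

context group begin

lemma right_coset_action:
  assumes S: "subgroup S G"
  shows "group_action G (rcosets S) (\<lambda>g. \<lambda>C\<in>rcosets S. C #> inv g)"
proof -
  interpret S: subgroup S G by (rule S)
  let ?E = "rcosets S" and ?\<phi> = "\<lambda>g. \<lambda>C\<in>rcosets S. C #> inv g"
  have sub: "C \<subseteq> carrier G" if "C \<in> ?E" for C
    using that rcosets_subset_PowG[OF S] by blast
  have mem: "C #> g \<in> ?E" if "C \<in> ?E" "g \<in> carrier G" for C g
    using that S.subset by (auto simp: RCOSETS_def coset_mult_assoc)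
  have bij: "?\<phi> g \<in> Bij ?E" if g: "g \<in> carrier G" for g
    unfolding Bij_def
    using g mem sub
    by (auto simp: coset_mult_assoc intro!: bij_betw_byWitness[of _ "\<lambda>C. C #> g"])
  have "?\<phi> \<in> hom G (BijGroup ?E)"
  proof (rule homI)
    fix g h assume gh: "g \<in> carrier G" "h \<in> carrier G"
    have "?\<phi> (g \<otimes> h) = compose ?E (?\<phi> g) (?\<phi> h)"
      using gh by (intro ext) (auto simp: compose_def mem sub coset_mult_assoc inv_mult_group)
    then show "?\<phi> (g \<otimes> h) = ?\<phi> g \<otimes>\<^bsub>BijGroup ?E\<^esub> ?\<phi> h"
      using bij gh by (simp add: BijGroup_def)
  qed (simp add: BijGroup_def bij)
  then show ?thesis
    by (simp add: group_action_def group_hom_def group_hom_axioms_def group_BijGroup is_group)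
qed

text \<open>
  The \<open>p\<close>-subgroup acts on the right cosets of \<open>S\<close>, whose number is prime to \<open>p\<close>. A fixed coset
  \<open>S #> n\<close> means exactly that conjugation by \<open>n\<close> moves \<open>P\<close> into \<open>S\<close>.
\<close>
lemma p_subgroup_conjugate_into_sylow:
  assumes fin: "finite (carrier G)" and p: "Factorial_Ring.prime p"
    and P: "subgroup P G" "card P = p ^ k" and S: "subgroup S G" "\<not> p dvd card (rcosets S)"
  obtains n where "n \<in> carrier G" "\<And>g. g \<in> P \<Longrightarrow> n \<otimes> g \<otimes> inv n \<in> S"
proof -
  interpret P: subgroup P G by (rule P)
  interpret S: subgroup S G by (rule S)
  have act: "group_action (G\<lparr>carrier := P\<rparr>) (rcosets S) (\<lambda>g. \<lambda>C\<in>rcosets S. C #> inv g)"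
    using group_action.induced_action[OF right_coset_action[OF S(1)] P(1)] .
  have finE: "finite (rcosets S)"
    using fin finite_subset[OF rcosets_subset_PowG[OF S(1)]] by simp
  obtain C where C: "C \<in> rcosets S"
    and fixed: "\<And>g. g \<in> P \<Longrightarrow> (\<lambda>C\<in>rcosets S. C #> inv g) C = C"
    by (rule p_group_action_fixed_point[OF act finE p _ S(2), of k]) (use P(2) in auto)
  obtain n where n: "n \<in> carrier G" "C = S #> n" using C by (auto simp: RCOSETS_def)
  have "n \<otimes> g \<otimes> inv n \<in> S" if g: "g \<in> P" for g
  proof -
    have "S #> n #> inv (inv g) = S #> n" using fixed[OF P.m_inv_closed[OF g]] C n by simp
    then have "S #> (n \<otimes> g) = S #> n" using g n S.subset P.subset by (simp add: coset_mult_assoc subset_iff)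
    then have "n \<otimes> g \<in> S #> n" using g n rcos_self[OF _ S(1), of "n \<otimes> g"] by auto
    then obtain s where "s \<in> S" "n \<otimes> g = s \<otimes> n" by (auto simp: r_coset_def)
    then show ?thesis using g n by (simp add: m_assoc)
  qed
  then show thesis using n that by blast
qed

text \<open>Sylow's second theorem reduces the claim to a Sylow subgroup, which is abelian.\<close>
lemma p_subgroup_commutes:
  assumes fin: "finite (carrier G)"
    and sylow: "\<And>p S. sylow_subgroup G p S \<Longrightarrow> comm_group (G\<lparr>carrier := S\<rparr>)"
    and p: "Factorial_Ring.prime p" and P: "subgroup P G" "card P = p ^ k" and xy: "x \<in> P" "y \<in> P"
  shows "x \<otimes> y = y \<otimes> x"
proof -
  let ?a = "multiplicity p (card (carrier G))"
  have pos: "card (carrier G) > 0" using fin order_gt_0_iff_finite by (simp add: Coset.order_def)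
  obtain m where m: "card (carrier G) = p ^ ?a * m" "\<not> p dvd m"
    using pos p multiplicity_decompose'[of "card (carrier G)" p] not_prime_unit by blast
  obtain S where S: "subgroup S G" "card S = p ^ ?a"
    using sylow_thm[OF p is_group _ fin, of ?a m] m(1) by (auto simp: Coset.order_def)
  have comm: "comm_group (G\<lparr>carrier := S\<rparr>)"
    using S p by (intro sylow[of p]) (simp add: sylow_subgroup_def)
  have "card (rcosets S) * p ^ ?a = p ^ ?a * m" using lagrange[OF S(1)] S(2) m(1) by (simp add: Coset.order_def)
  then have "card (rcosets S) = m" using p by (simp add: prime_gt_0_nat)
  then obtain n where n: "n \<in> carrier G" "\<And>g. g \<in> P \<Longrightarrow> n \<otimes> g \<otimes> inv n \<in> S"
    using p_subgroup_conjugate_into_sylow[OF fin p P S(1)] m(2) by blast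
  have xyG: "x \<in> carrier G" "y \<in> carrier G" using subgroup.mem_carrier[OF P(1)] xy by auto
  have cancel: "inv n \<otimes> (n \<otimes> z) = z" if "z \<in> carrier G" for z
    using n(1) that by (simp flip: m_assoc)
  have "n \<otimes> (x \<otimes> y) \<otimes> inv n = (n \<otimes> x \<otimes> inv n) \<otimes> (n \<otimes> y \<otimes> inv n)"
    using n(1) xyG by (simp add: m_assoc cancel)
  also have "\<dots> = (n \<otimes> y \<otimes> inv n) \<otimes> (n \<otimes> x \<otimes> inv n)"
    using comm_groupE(4)[OF comm] n(2) xy by simp
  also have "\<dots> = n \<otimes> (y \<otimes> x) \<otimes> inv n"
    using n(1) xyG by (simp add: m_assoc cancel)
  finally show ?thesis using n(1) xyG by (metis inv_closed m_closed l_cancel r_cancel)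
qed


lemma subgroup_nat_pow_closed: "subgroup H G \<Longrightarrow> a \<in> H \<Longrightarrow> a [^] (k :: nat) \<in> H"
  by (induction k) (auto simp: subgroup.m_closed subgroup.one_closed)

lemma conj_nat_pow:
  assumes "g \<in> carrier G" "b \<in> carrier G"
  shows "(g \<otimes> b \<otimes> inv g) [^] (k :: nat) = g \<otimes> b [^] k \<otimes> inv g"
proof (induction k)
  case (Suc k)
  have "inv g \<otimes> (g \<otimes> z) = z" if "z \<in> carrier G" for z
    using assms that by (simp flip: m_assoc)
  then show ?case using Suc assms by (simp add: m_assoc)
qed (use assms in simp)

text \<open>
  The exponent \<open>k * p\<close> is the least positive one whose power of \<open>a\<close> lies in \<open>Z\<close>, and \<open>p\<close> is a prime
  divisor of it.
\<close>
lemma exists_pow_prime_into: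
  assumes fin: "finite (carrier G)" and Z: "subgroup Z G" and a: "a \<in> carrier G" "a \<notin> Z"
  obtains p k where "Factorial_Ring.prime p" "a [^] (k :: nat) \<notin> Z" "a [^] (k * p) \<in> Z"
proof -
  have "a [^] ord a \<in> Z" "ord a > 0"
    using a subgroup.one_closed[OF Z] ord_ge_1[OF fin a(1)] by auto
  then have witness: "0 < ord a \<and> a [^] ord a \<in> Z" by blast
  define l where "l = (LEAST l. 0 < l \<and> a [^] (l :: nat) \<in> Z)"
  have l: "l > 0" "a [^] l \<in> Z" using LeastI[of "\<lambda>l. 0 < l \<and> a [^] l \<in> Z", OF witness] by (auto simp: l_def)
  have least: "a [^] j \<notin> Z" if "0 < j" "j < l" for j
    using not_less_Least[of j "\<lambda>l. 0 < l \<and> a [^] l \<in> Z"] that by (auto simp: l_def)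
  have "l \<noteq> 1" using l a by auto
  then obtain p where p: "Factorial_Ring.prime p" "p dvd l" using prime_factor_nat by blast
  then obtain k where k: "l = k * p" by (auto elim: dvdE simp: mult.commute)
  have "0 < k" "k < l" using l(1) k prime_gt_1_nat[OF p(1)] by auto
  then show thesis using that[of p k] p l(2) least[of k] k by auto
qed

lemma derived_psubset:
  assumes solv: "solvable G" and A: "subgroup A G" "A \<noteq> {\<one>}"
  shows "derived G A \<subset> A"
proof -
  obtain n where n: "(derived G ^^ n) A = {\<one>}"
    using solvable_imp_trivial_derived_seq[OF solvable_subgroup[OF A(1) solv]] by blast
  have "derived G A \<noteq> A"
  proof
    assume "derived G A = A"
    then have "(derived G ^^ n) A = A" by (induction n) auto
    then show False using n A(2) by simp
  qed
  then show ?thesis using derived_incl[OF subset_refl A(1)] by blast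
qed

text \<open>
  Take \<open>A\<close> of least order among the normal subgroups inside \<open>M\<close> that are not contained in \<open>Z\<close>. Its
  derived subgroup is normal and, by solvability, smaller, so it lies in \<open>Z\<close>. As \<open>A\<close> is abelian
  modulo \<open>Z\<close>, the elements of \<open>A\<close> with \<open>p\<close>-th power in \<open>Z\<close> form a normal subgroup; for a suitable prime
  it is not contained in \<open>Z\<close>, hence is all of \<open>A\<close>.
\<close>
lemma exists_elementary_abelian_section:
  assumes fin: "finite (carrier G)" and solv: "solvable G"
    and M: "M \<lhd> G" and Z: "Z \<lhd> G" "Z \<subseteq> M" "Z \<noteq> M"
  obtains A p where "A \<lhd> G" "A \<subseteq> M" "\<not> A \<subseteq> Z" "Factorial_Ring.prime p"
    "derived G A \<subseteq> Z" "\<And>a. a \<in> A \<Longrightarrow> a [^] (p :: nat) \<in> Z"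
proof -
  interpret Z: normal Z G by (rule Z)
  define good where "good A \<longleftrightarrow> A \<lhd> G \<and> A \<subseteq> M \<and> \<not> A \<subseteq> Z" for A
  have "good M" using M Z by (auto simp: good_def)
  then obtain A where A: "good A" "\<And>B. good B \<Longrightarrow> card A \<le> card B"
    using ex_has_least_nat[of good M card] by blast
  then interpret A: normal A G by (simp add: good_def)
  have finA: "finite A" using A.subset fin finite_subset by blast
  have minimal: "B \<subseteq> Z" if "B \<lhd> G" "B \<subset> A" for B
    using that A psubset_card_mono[OF finA that(2)] by (force simp: good_def)
  have "A \<noteq> {\<one>}" using A(1) Z.one_closed by (auto simp: good_def)
  then have "derived G A \<subset> A" using derived_psubset[OF solv A.subgroup_axioms] by simp
  then have derived: "derived G A \<subseteq> Z" using minimal derived_is_normal[OF A.normal_axioms] by simp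
  have commutator: "a \<otimes> b \<otimes> inv a \<otimes> inv b \<in> Z" if "a \<in> A" "b \<in> A" for a b
    using derived that by (auto simp: derived_def intro!: generate.incl)
  obtain a where a: "a \<in> A" "a \<notin> Z" using A(1) by (auto simp: good_def)
  then obtain p k where p: "Factorial_Ring.prime p"
    and k: "a [^] (k :: nat) \<notin> Z" "a [^] (k * p) \<in> Z"
    using exists_pow_prime_into[OF fin Z.subgroup_axioms] A.subset by blast
  define B where "B = {b \<in> A. b [^] p \<in> Z}"
  interpret \<pi>: group_hom G "G Mod Z" "\<lambda>x. Z #> x"
    using Z.r_coset_hom_Mod Z.factorgroup_is_group by (simp add: group_hom_def group_hom_axioms_def is_group)
  have in_Z: "x \<in> Z \<longleftrightarrow> Z #> x = \<one>\<^bsub>G Mod Z\<^esub>" if "x \<in> carrier G" for x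
    using coset_join1[OF _ that Z.subgroup_axioms] coset_join2[OF that Z.subgroup_axioms] by auto
  have commute: "(Z #> x) \<otimes>\<^bsub>G Mod Z\<^esub> (Z #> y) = (Z #> y) \<otimes>\<^bsub>G Mod Z\<^esub> (Z #> x)" if "x \<in> A" "y \<in> A" for x y
  proof -
    have xy: "x \<in> carrier G" "y \<in> carrier G" using that A.subset by auto
    have "x \<otimes> y = (x \<otimes> y \<otimes> inv x \<otimes> inv y) \<otimes> (y \<otimes> x)"
    proof -
      have "inv y \<otimes> (y \<otimes> x) = x" using xy by (simp flip: m_assoc)
      then show ?thesis using xy by (simp add: m_assoc)
    qed
    then have "Z #> (x \<otimes> y) = (Z #> (x \<otimes> y \<otimes> inv x \<otimes> inv y)) \<otimes>\<^bsub>G Mod Z\<^esub> (Z #> (y \<otimes> x))"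
      using xy by (metis \<pi>.hom_mult inv_closed m_closed)
    also have "Z #> (x \<otimes> y \<otimes> inv x \<otimes> inv y) = \<one>\<^bsub>G Mod Z\<^esub>"
      using commutator[OF that] by (subst in_Z[symmetric]) (use xy in auto)
    finally show ?thesis using xy \<pi>.hom_closed by (simp del: one_FactGroup mult_FactGroup)
  qed
  have "subgroup B G"
  proof
    show "B \<subseteq> carrier G" using A.subset by (auto simp: B_def)
    show "\<one> \<in> B" by (simp add: B_def)
    fix x assume x: "x \<in> B"
    then show "inv x \<in> B" using A.subset by (auto simp: B_def nat_pow_inv)
    fix y assume y: "y \<in> B"
    have xy: "x \<in> A" "y \<in> A" "x \<in> carrier G" "y \<in> carrier G" "x [^] p \<in> Z" "y [^] p \<in> Z"
      using x y A.subset by (auto simp: B_def)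
    have "Z #> (x \<otimes> y) [^] p = ((Z #> x) \<otimes>\<^bsub>G Mod Z\<^esub> (Z #> y)) [^]\<^bsub>G Mod Z\<^esub> p"
      using xy by (simp add: \<pi>.hom_nat_pow del: one_FactGroup mult_FactGroup)
    also have "\<dots> = (Z #> x) [^]\<^bsub>G Mod Z\<^esub> p \<otimes>\<^bsub>G Mod Z\<^esub> (Z #> y) [^]\<^bsub>G Mod Z\<^esub> p"
      using xy commute \<pi>.hom_closed by (intro \<pi>.H.pow_mult_distrib) auto
    also have "\<dots> = (Z #> x [^] p) \<otimes>\<^bsub>G Mod Z\<^esub> (Z #> y [^] p)"
      using xy by (simp add: \<pi>.hom_nat_pow del: one_FactGroup mult_FactGroup)
    also have "\<dots> = \<one>\<^bsub>G Mod Z\<^esub>"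
      using xy in_Z by (metis \<pi>.H.l_one \<pi>.H.one_closed nat_pow_closed)
    finally show "x \<otimes> y \<in> B" using xy in_Z by (auto simp: B_def)
  qed
  then have "B \<lhd> G"
    using A.inv_op_closed2 Z.inv_op_closed2 A.subset
    by (auto simp: normal_inv_iff B_def conj_nat_pow subset_iff)
  moreover have "a [^] k \<in> B" using k a A.subset by (auto simp: B_def nat_pow_pow subgroup_nat_pow_closed[OF A.subgroup_axioms])
  moreover have "B \<subseteq> A" by (auto simp: B_def)
  ultimately have "B = A" using minimal[of B] k(1) by blast
  then show thesis
    using that[of A p] A(1) p derived by (auto simp: good_def B_def)
qed

text \<open>
  The order of the coset of \<open>x\<close> divides both \<open>p\<close> and the index of \<open>T\<close>.
\<close>
lemma power_mem_normal_subgroup_coprime_index: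
  assumes fin: "finite (carrier G)" and T: "T \<lhd> G" and x: "x \<in> carrier G" "x [^] (p :: nat) \<in> T"
    and p: "Factorial_Ring.prime p" "\<not> p dvd card (rcosets T)"
  shows "x \<in> T"
proof -
  interpret T: normal T G by (rule T)
  interpret Q: group "G Mod T" by (rule T.factorgroup_is_group)
  interpret \<pi>: group_hom G "G Mod T" "\<lambda>x. T #> x"
    using T.r_coset_hom_Mod T.factorgroup_is_group by (simp add: group_hom_def group_hom_axioms_def is_group)
  have tx: "T #> x \<in> carrier (G Mod T)" using x by (rule_tac \<pi>.hom_closed)
  have "(T #> x) [^]\<^bsub>G Mod T\<^esub> p = T #> (x [^] p)" using x by (simp add: \<pi>.hom_nat_pow)
  also have "\<dots> = \<one>\<^bsub>G Mod T\<^esub>" using x coset_join2[OF _ T.subgroup_axioms x(2)] by simp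
  finally have "Q.ord (T #> x) dvd p" using Q.pow_eq_id[OF tx] by simp
  moreover have "Q.ord (T #> x) dvd card (rcosets T)"
  proof -
    have "finite (carrier (G Mod T))"
      using fin finite_subset[OF rcosets_subset_PowG[OF T.subgroup_axioms]] by (simp add: FactGroup_def)
    then show ?thesis using Q.ord_dvd_group_order[OF tx] by (simp add: Coset.order_def FactGroup_def)
  qed
  ultimately have "Q.ord (T #> x) = 1" using p by (metis prime_nat_iff)
  then have "T #> x = T"
    using Q.pow_ord_eq_1[OF tx] Q.nat_pow_eone[OF tx] by simp
  then show ?thesis using coset_join1[OF _ x(1) T.subgroup_axioms] by simp
qed

text \<open>
  Let \<open>P\<close> be a Sylow \<open>p\<close>-subgroup of \<open>A\<close> and \<open>T\<close> the product of \<open>A \<inter> Z\<close> and \<open>P\<close>. Commutators of \<open>A\<close> lie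
  in \<open>Z\<close>, so \<open>T\<close> is normal in \<open>A\<close>; its index is prime to \<open>p\<close>, while every \<open>p\<close>-th power of \<open>A\<close> lies in it.
\<close>
lemma factor_through_sylow:
  assumes fin: "finite (carrier G)" and Z: "Z \<lhd> G" and A: "subgroup A G"
    and derived: "derived G A \<subseteq> Z" and p: "Factorial_Ring.prime p"
    and exponent: "\<And>a. a \<in> A \<Longrightarrow> a [^] (p :: nat) \<in> Z"
  obtains P k where "subgroup P G" "P \<subseteq> A" "card P = p ^ k"
    "\<And>a. a \<in> A \<Longrightarrow> \<exists>z\<in>Z. \<exists>x\<in>P. a = z \<otimes> x"
proof -
  interpret Z: normal Z G by (rule Z)
  interpret A: subgroup A G by (rule A)
  let ?A = "G\<lparr>carrier := A\<rparr>"
  interpret GA: group ?A by (rule subgroup_imp_group[OF A])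
  have finA: "finite A" using A.subset fin finite_subset by blast
  have commutator: "a \<otimes> b \<otimes> inv a \<otimes> inv b \<in> Z" if "a \<in> A" "b \<in> A" for a b
    using derived that by (auto simp: derived_def intro!: generate.incl)
  have "card A \<noteq> 0" using finA A.one_closed by (metis card_eq_0_iff empty_iff)
  then obtain m where m: "card A = p ^ multiplicity p (card A) * m" "\<not> p dvd m"
    using p multiplicity_decompose'[of "card A" p] not_prime_unit by blast
  then obtain P where P: "subgroup P ?A" "card P = p ^ multiplicity p (card A)"
    using sylow_thm[OF p GA.is_group, of "multiplicity p (card A)" m] finA by (auto simp: Coset.order_def)
  have PG: "subgroup P G" using incl_subgroup[OF A P(1)] .
  interpret P: subgroup P G by (rule PG)
  have PA: "P \<subseteq> A" using subgroup.subset[OF P(1)] by simp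
  define T where "T = {a \<in> A. \<exists>z\<in>Z. \<exists>x\<in>P. a = z \<otimes> x}"
  have cancel: "inv u \<otimes> (u \<otimes> v) = v" "u \<otimes> (inv u \<otimes> v) = v"
    if "u \<in> carrier G" "v \<in> carrier G" for u v
    using that by (simp_all flip: m_assoc)
  have TI: "a \<in> T" if "a \<in> A" "z \<in> Z" "x \<in> P" "a = z \<otimes> x" for a z x
    using that by (auto simp: T_def)
  have PT: "P \<subseteq> T"
    using PA Z.one_closed P.subset by (auto intro!: TI[of _ \<one>])
  have TG: "subgroup T G"
  proof
    show "T \<subseteq> carrier G" using A.subset by (auto simp: T_def)
    show "\<one> \<in> T" using PT P.one_closed by blast
    fix a assume "a \<in> T"
    then obtain z x where a: "a \<in> A" "z \<in> Z" "x \<in> P" "a = z \<otimes> x" by (auto simp: T_def)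
    have zx: "z \<in> carrier G" "x \<in> carrier G" using a Z.subset P.subset by auto
    show "inv a \<in> T"
    proof (rule TI)
      show "inv x \<otimes> inv z \<otimes> x \<in> Z" using Z.inv_op_closed1[of x "inv z"] a zx by simp
      show "inv a = inv x \<otimes> inv z \<otimes> x \<otimes> inv x" using a zx by (simp add: inv_mult_group m_assoc)
    qed (use a in auto)
    fix b assume "b \<in> T"
    then obtain w y where b: "b \<in> A" "w \<in> Z" "y \<in> P" "b = w \<otimes> y" by (auto simp: T_def)
    have wy: "w \<in> carrier G" "y \<in> carrier G" using b Z.subset P.subset by auto
    show "a \<otimes> b \<in> T"
    proof (rule TI)
      show "z \<otimes> (x \<otimes> w \<otimes> inv x) \<in> Z" using Z.inv_op_closed2[of x w] a b zx by simp
      show "a \<otimes> b = z \<otimes> (x \<otimes> w \<otimes> inv x) \<otimes> (x \<otimes> y)" using a b zx wy by (simp add: m_assoc cancel)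
    qed (use a b in auto)
  qed
  have T: "subgroup T ?A" using subgroup_incl[OF TG A] by (auto simp: T_def)
  have "T \<lhd> ?A"
    unfolding GA.normal_inv_iff
  proof (intro conjI ballI T)
    fix b a assume "b \<in> carrier ?A" and "a \<in> T"
    then obtain z x where b: "b \<in> A" and a: "a \<in> A" "z \<in> Z" "x \<in> P" "a = z \<otimes> x" by (auto simp: T_def)
    have in_carrier: "z \<in> carrier G" "x \<in> carrier G" "b \<in> carrier G" using a b Z.subset P.subset A.subset by auto
    have "b \<otimes> a \<otimes> inv b \<in> T"
    proof (rule TI)
      show "(b \<otimes> z \<otimes> inv b) \<otimes> (b \<otimes> x \<otimes> inv b \<otimes> inv x) \<in> Z"
        using Z.inv_op_closed2[of b z] commutator[of b x] a b PA in_carrier by auto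
      show "b \<otimes> a \<otimes> inv b = (b \<otimes> z \<otimes> inv b) \<otimes> (b \<otimes> x \<otimes> inv b \<otimes> inv x) \<otimes> x"
        using a in_carrier by (simp add: m_assoc cancel)
    qed (use a b in auto)
    then show "b \<otimes>\<^bsub>?A\<^esub> a \<otimes>\<^bsub>?A\<^esub> inv\<^bsub>?A\<^esub> b \<in> T" using b A by simp
  qed
  moreover have "\<not> p dvd card (rcosets\<^bsub>?A\<^esub> T)"
  proof -
    have "card (rcosets\<^bsub>G\<lparr>carrier := T\<rparr>\<^esub> P) * card P = card T"
      using group.lagrange[OF subgroup_imp_group[OF TG] subgroup_incl[OF PG TG PT]]
      by (simp add: Coset.order_def)
    then have "card P dvd card T" by (metis dvd_triv_right)
    then obtain t where t: "card T = card P * t" by blast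
    have "card (rcosets\<^bsub>?A\<^esub> T) * card T = card A"
      using GA.lagrange[OF T] by (simp add: Coset.order_def)
    then have "card P * (card (rcosets\<^bsub>?A\<^esub> T) * t) = card P * m"
      using m(1) P(2) t by (simp add: mult_ac)
    moreover have "card P \<noteq> 0" using P(2) prime_gt_0_nat[OF p] by simp
    ultimately have "card (rcosets\<^bsub>?A\<^esub> T) * t = m" by simp
    then have "card (rcosets\<^bsub>?A\<^esub> T) dvd m" by auto
    then show ?thesis using m(2) dvd_trans by blast
  qed
  ultimately have "a \<in> T" if "a \<in> A" for a
  proof -
    have "a [^] p \<in> T"
      using exponent[OF that] that subgroup_nat_pow_closed[OF A, of a p] PT P.one_closed A.subset
      by (intro TI[of _ "a [^] p" \<one>]) auto
    then show ?thesis
      using GA.power_mem_normal_subgroup_coprime_index[of T a p] that finA p \<open>T \<lhd> ?A\<close>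
        \<open>\<not> p dvd card (rcosets\<^bsub>?A\<^esub> T)\<close> by (simp flip: nat_pow_consistent)
  qed
  then have "\<exists>z\<in>Z. \<exists>x\<in>P. a = z \<otimes> x" if "a \<in> A" for a
    using that by (auto simp: T_def)
  then show thesis using that PG PA P(2) by blast
qed

end

section \<open>Block idempotents\<close>

context matrix_representation begin

lemmas mat_assoc = assoc_mult_mat[of _ n n _ n _ n]

text \<open>
  The image of a block idempotent, together with its translates, is a system of imprimitivity of the
  subspace that they span: a group element either maps the block and its complement
  \<open>{v. e *\<^sub>v v = 0}\<close> to themselves, or maps the block into the complement.
\<close>
definition block :: "complex mat \<Rightarrow> bool" where
  "block e \<longleftrightarrow> e \<in> carrier_mat n n \<and> e \<noteq> 0\<^sub>m n n \<and> e * e = e \<and>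
     (\<forall>g\<in>carrier G. e * \<rho> g = \<rho> g * e \<or> e * \<rho> g * e = 0\<^sub>m n n)"

definition block_stabilizer :: "complex mat \<Rightarrow> 'a set" where
  "block_stabilizer e = {g \<in> carrier G. e * \<rho> g = \<rho> g * e}"

lemma block_carrier [simp]: "block e \<Longrightarrow> e \<in> carrier_mat n n"
  and block_idem: "block e \<Longrightarrow> e * e = e"
  and block_nonzero: "block e \<Longrightarrow> e \<noteq> 0\<^sub>m n n"
  by (simp_all add: block_def)

lemma block_stabilizer_subset: "block_stabilizer e \<subseteq> carrier G"
  by (auto simp: block_stabilizer_def)

lemma block_compress_outside:
  "block e \<Longrightarrow> g \<in> carrier G \<Longrightarrow> g \<notin> block_stabilizer e \<Longrightarrow> e * \<rho> g * e = 0\<^sub>m n n"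
  by (auto simp: block_def block_stabilizer_def)

lemma block_compress_inside:
  assumes "block e" "g \<in> block_stabilizer e"
  shows "e * \<rho> g * e = e * \<rho> g"
proof -
  have g: "g \<in> carrier G" "e * \<rho> g = \<rho> g * e" using assms(2) by (auto simp: block_stabilizer_def)
  have "e * \<rho> g * e = e * (\<rho> g * e)" using g(1) assms(1) by (simp add: mat_assoc)
  also have "\<dots> = e * (e * \<rho> g)" by (simp only: g(2))
  also have "\<dots> = e * e * \<rho> g" using g(1) assms(1) by (simp add: mat_assoc)
  finally show ?thesis using assms(1) by (simp add: block_idem)
qed

lemma block_stabilizer_subgroup:
  assumes e: "e \<in> carrier_mat n n"
  shows "subgroup (block_stabilizer e) G"
proof
  show "block_stabilizer e \<subseteq> carrier G" by (rule block_stabilizer_subset)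
  show "\<one> \<in> block_stabilizer e"
    using e by (simp add: block_stabilizer_def rho_one)
  fix x assume x: "x \<in> block_stabilizer e"
  then have x': "x \<in> carrier G" "e * \<rho> x = \<rho> x * e" by (auto simp: block_stabilizer_def)
  show "x \<otimes> y \<in> block_stabilizer e" if "y \<in> block_stabilizer e" for y
  proof -
    have y: "y \<in> carrier G" "e * \<rho> y = \<rho> y * e" using that by (auto simp: block_stabilizer_def)
    have "e * (\<rho> x * \<rho> y) = \<rho> x * (e * \<rho> y)"
      using x' y(1) e by (simp flip: mat_assoc)
    then show ?thesis
      using x' y e by (simp add: block_stabilizer_def rho_mult mat_assoc)
  qed
  have "e * \<rho> (inv x) = \<rho> (inv x) * (\<rho> x * e) * \<rho> (inv x)"
    using x' e by (simp add: rho_inv flip: mat_assoc)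
  also have "\<dots> = \<rho> (inv x) * (e * (\<rho> x * \<rho> (inv x)))"
    using x' e by (simp add: mat_assoc flip: x'(2))
  also have "\<dots> = \<rho> (inv x) * e" using x' e by (simp add: rho_inv)
  finally show "inv x \<in> block_stabilizer e" using x' by (simp add: block_stabilizer_def)
qed

text \<open>
  The sum over all conjugates is scalar by Schur's lemma. Multiplication by \<open>e\<close> kills every
  conjugate except those by the stabilizer, which are equal to \<open>e\<close>, and so determines the scalar. In
  other words, the distinct conjugates of \<open>e\<close> add up to the identity.
\<close>
lemma block_average:
  assumes sc: "scalar_commutant G n \<rho>" and e: "block e"
  shows "mat_sum n (carrier G) (\<lambda>x. \<rho> x * e * \<rho> (inv x)) = of_nat (card (block_stabilizer e)) \<cdot>\<^sub>m 1\<^sub>m n"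
    (is "?C = _")
proof -
  interpret U: subgroup "block_stabilizer e" G
    using e by (intro block_stabilizer_subgroup) simp
  have fin: "finite (block_stabilizer e)" using U.subset finite_carrier finite_subset by blast
  obtain c where c: "?C = c \<cdot>\<^sub>m 1\<^sub>m n"
    using conjugation_average_scalar[OF sc block_carrier[OF e]] by blast
  have "?C * e = mat_sum n (carrier G) (\<lambda>x. \<rho> x * (e * \<rho> (inv x) * e))"
    using e by (subst mat_sum_mult_right) (auto intro!: mat_sum_cong simp: mat_assoc)
  also have "\<dots> = mat_sum n (block_stabilizer e) (\<lambda>x. \<rho> x * (e * \<rho> (inv x) * e))"
  proof (rule mat_sum_restrict[OF finite_carrier U.subset])
    fix x assume x: "x \<in> carrier G - block_stabilizer e"
    then have "inv x \<notin> block_stabilizer e" using U.m_inv_closed[of "inv x"] by auto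
    then have "e * \<rho> (inv x) * e = 0\<^sub>m n n" using x e by (intro block_compress_outside) auto
    then show "\<rho> x * (e * \<rho> (inv x) * e) = 0\<^sub>m n n" using x by (simp add: right_mult_zero_mat[of _ n n])
  qed
  also have "\<dots> = mat_sum n (block_stabilizer e) (\<lambda>x. e)"
  proof (rule mat_sum_cong)
    fix x assume x: "x \<in> block_stabilizer e"
    have "e * \<rho> (inv x) * e = e * \<rho> (inv x)" using x e by (intro block_compress_inside) auto
    also have "\<dots> = \<rho> (inv x) * e" using U.m_inv_closed[OF x] unfolding block_stabilizer_def by blast
    finally have "\<rho> x * (e * \<rho> (inv x) * e) = \<rho> x * \<rho> (inv x) * e"
      using x e U.subset by (auto simp: mat_assoc)
    then show "\<rho> x * (e * \<rho> (inv x) * e) = e" using x e U.subset by (auto simp: rho_inv)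
  qed
  also have "\<dots> = of_nat (card (block_stabilizer e)) \<cdot>\<^sub>m e"
    using e by (intro mat_sum_const) simp
  finally have eq: "c \<cdot>\<^sub>m e = of_nat (card (block_stabilizer e)) \<cdot>\<^sub>m e"
    using e by (simp add: c mult_smult_assoc_mat[of _ n n _ n] left_mult_one_mat[of _ n n])
  have "c = of_nat (card (block_stabilizer e))"
    by (rule smult_mat_cancel[OF eq block_carrier[OF e] block_nonzero[OF e]])
  then show ?thesis using c by simp
qed

text \<open>
  Multiply the identity of the preceding lemma by \<open>\<rho> g\<close> and take traces. Outside the stabilizer the
  trace of \<open>e * \<rho> y = e * e * \<rho> y\<close> equals that of \<open>e * \<rho> y * e = 0\<close>, so what remains is the formula for an
  induced character.
\<close>
lemma trace_as_induced:
  assumes sc: "scalar_commutant G n \<rho>" and e: "block e" and g: "g \<in> carrier G"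
  shows "mat_trace (\<rho> g) = (\<Sum>x\<in>carrier G. if x \<otimes> g \<otimes> inv x \<in> block_stabilizer e
           then mat_trace (e * \<rho> (x \<otimes> g \<otimes> inv x)) else 0) / of_nat (card (block_stabilizer e))"
proof -
  let ?C = "mat_sum n (carrier G) (\<lambda>x. \<rho> x * e * \<rho> (inv x))"
  interpret U: subgroup "block_stabilizer e" G
    using e by (intro block_stabilizer_subgroup) simp
  have fin: "finite (block_stabilizer e)" using U.subset finite_carrier finite_subset by blast
  have outside: "mat_trace (e * \<rho> y) = 0" if "y \<in> carrier G" "y \<notin> block_stabilizer e" for y
  proof -
    have "mat_trace (e * \<rho> y) = mat_trace (e * (e * \<rho> y))"
      using that e by (simp add: block_idem flip: mat_assoc)
    also have "\<dots> = mat_trace (e * \<rho> y * e)"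
      using that e by (intro mat_trace_comm[of _ n]) auto
    also have "e * \<rho> y * e = 0\<^sub>m n n" using e that by (rule block_compress_outside)
    finally show ?thesis by (simp add: mat_trace_def)
  qed
  have "of_nat (card (block_stabilizer e)) * mat_trace (\<rho> g) = mat_trace (?C * \<rho> g)"
    unfolding block_average[OF sc e]
    using g by (simp add: mult_smult_assoc_mat[of _ n n _ n] mat_trace_smult[of _ n] left_mult_one_mat[of _ n n])
  also have "?C * \<rho> g = mat_sum n (carrier G) (\<lambda>x. \<rho> x * e * \<rho> (inv x) * \<rho> g)"
    using e g by (subst mat_sum_mult_right) auto
  also have "mat_trace \<dots> = (\<Sum>x\<in>carrier G. mat_trace (\<rho> x * e * \<rho> (inv x) * \<rho> g))"
    using e g by (intro mat_trace_sum) auto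
  also have "\<dots> = (\<Sum>x\<in>carrier G. mat_trace (e * \<rho> (inv x \<otimes> g \<otimes> inv (inv x))))"
  proof (rule sum.cong)
    fix x assume x: "x \<in> carrier G"
    have "mat_trace (\<rho> x * (e * \<rho> (inv x) * \<rho> g)) = mat_trace (e * \<rho> (inv x) * \<rho> g * \<rho> x)"
      using x e g by (intro mat_trace_comm[of _ n]) auto
    then show "mat_trace (\<rho> x * e * \<rho> (inv x) * \<rho> g) = mat_trace (e * \<rho> (inv x \<otimes> g \<otimes> inv (inv x)))"
      using x e g by (simp add: rho_mult mat_assoc)
  qed simp
  also have "\<dots> = (\<Sum>x\<in>carrier G. mat_trace (e * \<rho> (x \<otimes> g \<otimes> inv x)))"
    by (rule sum.reindex_bij_betw[of "\<lambda>x. inv x"], rule bij_betw_byWitness[of _ "\<lambda>x. inv x"]) auto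
  also have "\<dots> = (\<Sum>x\<in>carrier G. if x \<otimes> g \<otimes> inv x \<in> block_stabilizer e
           then mat_trace (e * \<rho> (x \<otimes> g \<otimes> inv x)) else 0)"
    using g by (intro sum.cong) (auto simp: outside)
  moreover have "card (block_stabilizer e) \<noteq> 0"
    using fin U.one_closed by (metis card_eq_0_iff empty_iff)
  ultimately show ?thesis by (simp add: field_simps)
qed

text \<open>
  By Burnside's theorem this expresses that the representation remains irreducible on \<open>N\<close>.
\<close>
definition spanned_by :: "'a set \<Rightarrow> bool" where
  "spanned_by N \<longleftrightarrow> (\<forall>Y\<in>carrier_mat n n. \<exists>c. Y = mat_sum n N (\<lambda>x. c x \<cdot>\<^sub>m \<rho> x))"

text \<open>
  The terms outside the stabilizer vanish. Hence compressing a spanning set to the image of \<open>e\<close> shows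
  that the elements of \<open>N\<close> in the stabilizer span all endomorphisms of that image.
\<close>
lemma block_compression:
  assumes span: "spanned_by N" and N: "N \<subseteq> carrier G" and e: "block e" and Y: "Y \<in> carrier_mat n n"
  obtains c where "e * Y * e = mat_sum n (N \<inter> block_stabilizer e) (\<lambda>x. c x \<cdot>\<^sub>m (e * \<rho> x))"
proof -
  obtain c where c: "Y = mat_sum n N (\<lambda>x. c x \<cdot>\<^sub>m \<rho> x)"
    using span Y by (auto simp: spanned_by_def)
  have mem: "x \<in> carrier G" if "x \<in> N" for x using that N by blast
  have "e * Y * e = mat_sum n N (\<lambda>x. c x \<cdot>\<^sub>m (e * \<rho> x * e))"
    using e mem unfolding c
    by (subst mat_sum_mult_left, simp, simp, subst mat_sum_mult_right, simp, simp)
       (auto intro!: mat_sum_cong simp: mult_smult_assoc_mat[of _ n n _ n] mult_smult_distrib[of _ n n _ n])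
  also have "\<dots> = mat_sum n (N \<inter> block_stabilizer e) (\<lambda>x. c x \<cdot>\<^sub>m (e * \<rho> x * e))"
    using N finite_carrier mem e
    by (intro mat_sum_restrict) (auto simp: block_compress_outside finite_subset)
  also have "\<dots> = mat_sum n (N \<inter> block_stabilizer e) (\<lambda>x. c x \<cdot>\<^sub>m (e * \<rho> x))"
    using e by (intro mat_sum_cong) (simp add: block_compress_inside)
  finally show thesis by (rule that)
qed

text \<open>
  Irreducibility of the action of \<open>N \<inter> block_stabilizer e\<close> on the image of \<open>e\<close>, in the form of Schur's
  lemma: \<open>f\<close> commutes with every \<open>e * Y * e\<close>, therefore it is a multiple of \<open>e\<close>, and an idempotent multiple
  is \<open>e\<close> itself.
\<close>
lemma block_minimal:
  assumes span: "spanned_by N" and N: "N \<subseteq> carrier G" and e: "block e"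
    and f: "f \<in> carrier_mat n n" "f \<noteq> 0\<^sub>m n n" "f * f = f" "e * f = f" "f * e = f"
    and comm: "\<And>x. x \<in> N \<inter> block_stabilizer e \<Longrightarrow> f * \<rho> x = \<rho> x * f"
  shows "f = e"
proof -
  note [simp] = block_carrier[OF e] f(1)
  have swap: "f * Y * e = e * Y * f" if Y: "Y \<in> carrier_mat n n" for Y
  proof -
    obtain c where c: "e * Y * e = mat_sum n (N \<inter> block_stabilizer e) (\<lambda>x. c x \<cdot>\<^sub>m (e * \<rho> x))"
      using block_compression[OF span N e Y] .
    have mem: "x \<in> carrier G" if "x \<in> N \<inter> block_stabilizer e" for x using that N by blast
    have comm': "f * (e * \<rho> x) = e * \<rho> x * f" if x: "x \<in> N \<inter> block_stabilizer e" for x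
    proof -
      have "f * (e * \<rho> x) = f * \<rho> x" using mem[OF x] f by (simp flip: mat_assoc)
      also have "\<dots> = \<rho> x * (e * f)" using comm[OF x] f by simp
      also have "\<dots> = e * \<rho> x * f" using x mem[OF x] by (simp add: block_stabilizer_def mat_assoc)
      finally show ?thesis .
    qed
    have "f * (e * Y * e) = e * Y * e * f"
      unfolding c using mem
      by (subst mat_sum_mult_left, simp, simp, subst mat_sum_mult_right, simp, simp)
         (auto intro!: mat_sum_cong simp: mult_smult_assoc_mat[of _ n n _ n] mult_smult_distrib[of _ n n _ n] comm')
    moreover have "f * (e * Y * e) = f * Y * e"
      using Y f by (simp flip: mat_assoc)
    moreover have "e * Y * e * f = e * Y * f"
      using Y f by (simp add: mat_assoc)
    ultimately show ?thesis by simp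
  qed
  \<comment> \<open>With \<open>Y\<close> a matrix unit, this says that \<open>f\<close> and \<open>e\<close> have proportional entries.\<close>
  have entries: "f $$ (a, i) * e $$ (j, b) = e $$ (a, i) * f $$ (j, b)"
    if "a < n" "i < n" "j < n" "b < n" for a i j b
    using arg_cong[OF swap[OF mat_unit_carrier[of n i j]], of "\<lambda>A. A $$ (a, b)"] that
    by (simp add: mult_mat_unit_mult_index[of _ n] del: index_mult_mat)
  obtain j b where jb: "j < n" "b < n" "e $$ (j, b) \<noteq> 0"
    using nonzero_entry[of e n] block_nonzero[OF e] by auto
  define c where "c = f $$ (j, b) / e $$ (j, b)"
  have fc: "f = c \<cdot>\<^sub>m e"
  proof (rule eq_matI)
    fix a i assume "a < dim_row (c \<cdot>\<^sub>m e)" "i < dim_col (c \<cdot>\<^sub>m e)"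
    then have "a < n" "i < n" using carrier_matD[OF block_carrier[OF e]] by auto
    then show "f $$ (a, i) = (c \<cdot>\<^sub>m e) $$ (a, i)"
      using entries[of a i j b] jb carrier_matD[OF block_carrier[OF e]] by (simp add: c_def field_simps)
  qed (use carrier_matD[OF f(1)] carrier_matD[OF block_carrier[OF e]] in auto)
  have "f * f = c \<cdot>\<^sub>m (e * f)"
    using mult_smult_assoc_mat[of e n n f n c] fc by simp
  then have cf: "f = c \<cdot>\<^sub>m f" using f by simp
  obtain k l where kl: "k < n" "l < n" "f $$ (k, l) \<noteq> 0"
    using nonzero_entry[of f n] f by auto
  have "f $$ (k, l) = (c \<cdot>\<^sub>m f) $$ (k, l)" using cf by simp
  then have "c = 1" using kl carrier_matD[OF f(1)] by simp
  then show ?thesis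
    using fc carrier_matD[OF block_carrier[OF e]] by (auto intro!: eq_matI)
qed

text \<open>
  Choosing a matrix unit for \<open>Y\<close> at a nonzero entry of \<open>e\<close> identifies the scalar as that entry; summing
  the diagonal entries of the resulting identity and using \<open>e * e = e\<close> then shows that the trace is 1.
\<close>
lemma block_trace_one:
  assumes e: "block e" and rank1: "\<And>Y. Y \<in> carrier_mat n n \<Longrightarrow> \<exists>c. e * Y * e = c \<cdot>\<^sub>m e"
  shows "mat_trace e = 1"
proof -
  note [simp] = block_carrier[OF e] carrier_matD[OF block_carrier[OF e]]
  obtain j i where ji: "j < n" "i < n" "e $$ (j, i) \<noteq> 0"
    using nonzero_entry[of e n] block_nonzero[OF e] by auto
  obtain c where c: "e * mat_unit n i j * e = c \<cdot>\<^sub>m e" using rank1 by (metis mat_unit_carrier)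
  have entries: "e $$ (a, i) * e $$ (j, b) = c * e $$ (a, b)" if "a < n" "b < n" for a b
    using arg_cong[OF c, of "\<lambda>A. A $$ (a, b)"] that ji
    by (simp add: mult_mat_unit_mult_index[of _ n] del: index_mult_mat)
  have "c = e $$ (j, i)" using entries[of j i] ji by simp
  moreover have "e $$ (j, i) = c * mat_trace e"
  proof -
    have "e $$ (j, i) = (\<Sum>a<n. e $$ (j, a) * e $$ (a, i))"
      using mult_index[of e n e j i] ji block_idem[OF e] by simp
    also have "\<dots> = (\<Sum>a<n. c * e $$ (a, a))" by (intro sum.cong) (auto simp: entries[symmetric])
    finally show ?thesis by (simp add: mat_trace_def sum_distrib_left)
  qed
  ultimately show ?thesis using ji by auto
qed

lemma rank_one_block_linear_character:
  assumes e: "block e" and rank1: "\<And>Y. Y \<in> carrier_mat n n \<Longrightarrow> \<exists>c. e * Y * e = c \<cdot>\<^sub>m e"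
  shows "linear_character (G\<lparr>carrier := block_stabilizer e\<rparr>) (\<lambda>u\<in>block_stabilizer e. mat_trace (e * \<rho> u))"
proof -
  let ?U = "block_stabilizer e"
  interpret U: subgroup ?U G using e by (intro block_stabilizer_subgroup) simp
  note [simp] = block_carrier[OF e]
  define lam where "lam u = mat_trace (e * \<rho> u)" for u
  have lam: "e * \<rho> u = lam u \<cdot>\<^sub>m e" if u: "u \<in> ?U" for u
  proof -
    obtain c where c: "e * \<rho> u * e = c \<cdot>\<^sub>m e" using rank1 u U.subset by (meson rho_carrier subsetD)
    then have c': "e * \<rho> u = c \<cdot>\<^sub>m e" using block_compress_inside[OF e u] by simp
    then have "lam u = c" by (simp add: lam_def mat_trace_smult[of _ n] block_trace_one[OF e rank1])
    then show ?thesis using c' by simp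
  qed
  have lam_mult: "lam (u \<otimes> v) = lam u * lam v" if u: "u \<in> ?U" and v: "v \<in> ?U" for u v
  proof -
    have "e * \<rho> (u \<otimes> v) = (e * \<rho> u) * \<rho> v"
      using u v U.subset by (subst rho_mult) (auto simp: mat_assoc)
    also have "\<dots> = lam u \<cdot>\<^sub>m (lam v \<cdot>\<^sub>m e)"
      using u v U.subset by (auto simp: lam mult_smult_assoc_mat[of _ n n _ n])
    finally have "lam (u \<otimes> v) = mat_trace (lam u \<cdot>\<^sub>m (lam v \<cdot>\<^sub>m e))" by (simp add: lam_def)
    also have "\<dots> = lam u * lam v"
      by (simp add: mat_trace_smult[of _ n] block_trace_one[OF e rank1])
    finally show ?thesis .
  qed
  have lam_one: "lam \<one> = 1"
    by (simp add: lam_def rho_one right_mult_one_mat[of _ n n] block_trace_one[OF e rank1])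
  define M where "M u = mat 1 1 (\<lambda>_. lam u)" for u
  have M_mult: "M u * M v = M (u \<otimes> v)" if "u \<in> ?U" "v \<in> ?U" for u v
    using that by (intro eq_matI) (auto simp: M_def lam_mult scalar_prod_def)
  have M_one: "M \<one> = 1\<^sub>m 1" by (intro eq_matI) (auto simp: M_def lam_one)
  have "M u \<in> Units (ring_mat TYPE(complex) 1 ())" if u: "u \<in> ?U" for u
  proof -
    have "M u * M (inv u) = 1\<^sub>m 1" "M (inv u) * M u = 1\<^sub>m 1"
      using u U.subset by (auto simp: M_mult M_one)
    then show ?thesis by (auto simp: Units_def ring_mat_simps M_def intro!: bexI[of _ "M (inv u)"])
  qed
  then have "representation (G\<lparr>carrier := ?U\<rparr>) 1 M"
    by (auto simp: representation_def GL_def hom_def units_of_def ring_mat_simps M_mult)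
  moreover have "(\<lambda>u\<in>?U. mat_trace (e * \<rho> u)) = char_of_rep (G\<lparr>carrier := ?U\<rparr>) M"
    by (auto simp: char_of_rep_def mat_trace_def M_def lam_def)
  moreover have "(\<lambda>u\<in>?U. mat_trace (e * \<rho> u)) \<one>\<^bsub>G\<lparr>carrier := ?U\<rparr>\<^esub> = 1"
    using lam_one U.one_closed by (simp add: lam_def)
  ultimately show ?thesis
    unfolding linear_character_def is_character_def by blast
qed

end

section \<open>Weights of an abelian normal subgroup\<close>

lemma primitive_root_of_unity:
  assumes "N > 0"
  obtains \<omega> :: complex where "\<omega> ^ N = 1" "\<And>k. 0 < k \<Longrightarrow> k < N \<Longrightarrow> \<omega> ^ k \<noteq> 1"
proof
  let ?\<omega> = "cis (2 * pi / real N)"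
  have power: "?\<omega> ^ k = cis (2 * pi * real k / real N)" for k
    by (simp add: DeMoivre mult_ac)
  then show "?\<omega> ^ N = 1" using assms by simp
  fix k assume k: "0 < k" "k < N"
  have inj: "inj_on (\<lambda>k. cis (2 * pi * real k / real N)) {..<N}"
    using bij_betw_roots_unity[OF assms] by (rule bij_betw_imp_inj_on)
  show "?\<omega> ^ k \<noteq> 1"
    using inj_onD[OF inj, of k 0] k power by auto
qed

context matrix_representation begin

text \<open>
  The discrete Fourier transform of the orbit of \<open>q\<close> under \<open>a\<close> consists of eigenvectors of \<open>\<rho> a\<close>. They
  cannot all vanish, because they add up to \<open>ord a\<close> times \<open>q\<close>. The explicit form is needed later:
  whatever commutes with all powers of \<open>a\<close> acts on the eigenvector as it acts on \<open>q\<close>.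
\<close>
lemma eigencomponent:
  assumes a: "a \<in> carrier G" and q: "q \<in> carrier_mat n n" "q \<noteq> 0\<^sub>m n n"
  obtains c d where "\<rho> a * mat_sum n {..<ord a} (\<lambda>k. c ^ k \<cdot>\<^sub>m (\<rho> (a [^] k) * q))
      = d \<cdot>\<^sub>m mat_sum n {..<ord a} (\<lambda>k. c ^ k \<cdot>\<^sub>m (\<rho> (a [^] k) * q))"
    "mat_sum n {..<ord a} (\<lambda>k. c ^ k \<cdot>\<^sub>m (\<rho> (a [^] k) * q)) \<noteq> 0\<^sub>m n n"
proof -
  let ?N = "ord a"
  define T where "T k = \<rho> (a [^] (k :: nat)) * q" for k
  define w where "w c = mat_sum n {..<?N} (\<lambda>k. c ^ k \<cdot>\<^sub>m T k)" for c
  have T [simp]: "T k \<in> carrier_mat n n" for k using a q by (simp add: T_def)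
  note [simp] = carrier_matD[OF T]
  have N: "?N > 0" using ord_ge_1[OF finite_carrier a] by simp
  have T_Suc: "\<rho> a * T k = T (Suc k)" for k
    using a q by (simp only: T_def nat_pow_Suc2[OF a]) (simp add: rho_mult mat_assoc)
  have T_period: "T ?N = T 0" using a by (simp add: T_def)
  obtain \<omega> :: complex where \<omega>: "\<omega> ^ ?N = 1" "\<And>k. 0 < k \<Longrightarrow> k < ?N \<Longrightarrow> \<omega> ^ k \<noteq> 1"
    using primitive_root_of_unity[OF N] by blast
  have eigen: "\<rho> a * w c = inverse c \<cdot>\<^sub>m w c" if c: "c ^ ?N = 1" for c
  proof -
    have c0: "c \<noteq> 0" using c N by (auto simp: power_0_left)
    have "\<rho> a * w c = mat_sum n {..<?N} (\<lambda>k. c ^ k \<cdot>\<^sub>m T (Suc k))"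
      using a unfolding w_def
      by (subst mat_sum_mult_left) (auto intro!: mat_sum_cong simp: mult_smult_distrib[of _ n n _ n] T_Suc)
    also have "\<dots> = inverse c \<cdot>\<^sub>m w c"
    proof (rule eq_matI)
      fix i j assume "i < dim_row (inverse c \<cdot>\<^sub>m w c)" "j < dim_col (inverse c \<cdot>\<^sub>m w c)"
      then have ij: "i < n" "j < n" by (auto simp: w_def)
      define F where "F k = c ^ k * T k $$ (i, j)" for k
      have "(\<Sum>k<?N. c ^ k * T (Suc k) $$ (i, j)) = inverse c * (\<Sum>k<?N. F (Suc k))"
        using c0 by (auto simp: sum_distrib_left F_def field_simps intro!: sum.cong)
      also have "(\<Sum>k<?N. F (Suc k)) = (\<Sum>k<?N. F k)"
        using sum.lessThan_Suc[of F ?N] sum.lessThan_Suc_shift[of F ?N] c T_period by (simp add: F_def)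
      finally show "mat_sum n {..<?N} (\<lambda>k. c ^ k \<cdot>\<^sub>m T (Suc k)) $$ (i, j) = (inverse c \<cdot>\<^sub>m w c) $$ (i, j)"
        using ij by (simp add: w_def F_def)
    qed (auto simp: w_def)
    finally show ?thesis .
  qed
  have "\<exists>m<?N. w (\<omega> ^ m) \<noteq> 0\<^sub>m n n"
  proof (rule ccontr)
    assume "\<not> ?thesis"
    then have zero: "w (\<omega> ^ m) = 0\<^sub>m n n" if "m < ?N" for m using that by blast
    obtain i j where ij: "i < n" "j < n" "q $$ (i, j) \<noteq> 0" using nonzero_entry[OF q] .
    have geometric: "(\<Sum>m<?N. (\<omega> ^ m) ^ k) = (if k = 0 then of_nat ?N else 0)" if "k < ?N" for k
    proof (cases "k = 0")
      case False
      then have "(\<Sum>m<?N. (\<omega> ^ k) ^ m) = ((\<omega> ^ k) ^ ?N - 1) / (\<omega> ^ k - 1)"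
        using \<omega>(2) that by (intro geometric_sum) auto
      also have "(\<omega> ^ k) ^ ?N = 1" using \<omega>(1) by (metis power_mult mult.commute power_one)
      finally have "(\<Sum>m<?N. (\<omega> ^ k) ^ m) = 0" by simp
      then show ?thesis using False by (simp add: mult.commute flip: power_mult)
    qed simp
    have "0 = (\<Sum>m<?N. w (\<omega> ^ m) $$ (i, j))" using ij by (simp add: zero)
    also have "\<dots> = (\<Sum>m<?N. \<Sum>k<?N. (\<omega> ^ m) ^ k * T k $$ (i, j))"
      using ij by (simp add: w_def)
    also have "\<dots> = (\<Sum>k<?N. (\<Sum>m<?N. (\<omega> ^ m) ^ k) * T k $$ (i, j))"
      by (subst sum.swap) (simp add: sum_distrib_right)
    also have "\<dots> = (\<Sum>k<?N. if k = 0 then of_nat ?N * T k $$ (i, j) else 0)"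
      by (intro sum.cong) (auto simp: geometric)
    also have "\<dots> = of_nat ?N * q $$ (i, j)" using N q by (simp add: T_def rho_one)
    finally show False using N ij(3) by simp
  qed
  then obtain m where m: "w (\<omega> ^ m) \<noteq> 0\<^sub>m n n" by blast
  have "(\<omega> ^ m) ^ ?N = 1" using \<omega>(1) by (metis power_mult mult.commute power_one)
  from eigen[OF this] m show thesis by (intro that[of "\<omega> ^ m"]) (auto simp: w_def T_def)
qed

text \<open>
  The eigenvectors are collected in the columns of a matrix \<open>q\<close>. Elements of \<open>A\<close> are diagonalized one
  after another: passing to an eigencomponent of the next element keeps the previous
  eigenvalues, because the matrices commute on the image of \<open>e\<close>.
\<close>
lemma common_eigenvector:
  assumes e: "block e" and A: "subgroup A G"
    and comm: "\<And>a b. a \<in> A \<Longrightarrow> b \<in> A \<Longrightarrow> \<rho> a * \<rho> b * e = \<rho> b * \<rho> a * e"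
    and stab: "A \<subseteq> block_stabilizer e"
  obtains q \<mu> where "q \<in> carrier_mat n n" "q \<noteq> 0\<^sub>m n n" "e * q = q" "\<And>a. a \<in> A \<Longrightarrow> \<rho> a * q = \<mu> a \<cdot>\<^sub>m q"
proof -
  interpret A: subgroup A G by (rule A)
  note [simp] = block_carrier[OF e]
  have "\<exists>q\<in>carrier_mat n n. q \<noteq> 0\<^sub>m n n \<and> e * q = q \<and> (\<forall>a\<in>B. \<exists>c. \<rho> a * q = c \<cdot>\<^sub>m q)"
    if "finite B" "B \<subseteq> A" for B
    using that
  proof (induction B)
    case empty
    then show ?case using block_nonzero[OF e] block_idem[OF e] by (intro bexI[of _ e]) auto
  next
    case (insert a B)
    then obtain q where q: "q \<in> carrier_mat n n" "q \<noteq> 0\<^sub>m n n" "e * q = q"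
      and eig: "\<And>b. b \<in> B \<Longrightarrow> \<exists>c. \<rho> b * q = c \<cdot>\<^sub>m q" by auto
    have a: "a \<in> A" "a \<in> carrier G" using insert by auto
    note q(1) [simp]
    obtain c d where cd: "\<rho> a * mat_sum n {..<ord a} (\<lambda>k. c ^ k \<cdot>\<^sub>m (\<rho> (a [^] k) * q))
          = d \<cdot>\<^sub>m mat_sum n {..<ord a} (\<lambda>k. c ^ k \<cdot>\<^sub>m (\<rho> (a [^] k) * q))"
      "mat_sum n {..<ord a} (\<lambda>k. c ^ k \<cdot>\<^sub>m (\<rho> (a [^] k) * q)) \<noteq> 0\<^sub>m n n"
      using eigencomponent[OF a(2) q(1,2)] .
    define w where "w = mat_sum n {..<ord a} (\<lambda>k. c ^ k \<cdot>\<^sub>m (\<rho> (a [^] k) * q))"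
    have commute_pow: "Y * w = mat_sum n {..<ord a} (\<lambda>k. c ^ k \<cdot>\<^sub>m (\<rho> (a [^] k) * (Y * q)))"
      if Y: "Y \<in> carrier_mat n n" "\<And>k. Y * (\<rho> (a [^] (k :: nat)) * q) = \<rho> (a [^] k) * (Y * q)" for Y
      using a Y unfolding w_def
      by (subst mat_sum_mult_left) (auto intro!: mat_sum_cong simp: mult_smult_distrib[of _ n n _ n])
    have pow: "a [^] k \<in> A" for k :: nat using subgroup_nat_pow_closed[OF A a(1)] .
    have "e * w = w"
    proof -
      have "e * (\<rho> (a [^] k) * q) = \<rho> (a [^] k) * (e * q)" for k :: nat
      proof -
        have "e * \<rho> (a [^] k) = \<rho> (a [^] k) * e" using pow[of k] stab by (auto simp: block_stabilizer_def)
        then show ?thesis using a by (simp flip: mat_assoc)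
      qed
      from commute_pow[OF _ this] show ?thesis using q(3) by (simp add: w_def)
    qed
    moreover have "\<exists>c. \<rho> b * w = c \<cdot>\<^sub>m w" if b: "b \<in> B" for b
    proof -
      have bA: "b \<in> A" "b \<in> carrier G" using b insert by auto
      obtain c' where c': "\<rho> b * q = c' \<cdot>\<^sub>m q" using eig[OF b] by blast
      have "\<rho> b * (\<rho> (a [^] k) * q) = \<rho> (a [^] k) * (\<rho> b * q)" for k :: nat
      proof -
        have "\<rho> b * (\<rho> (a [^] k) * (e * q)) = (\<rho> b * \<rho> (a [^] k) * e) * q"
          using a bA by (simp add: mat_assoc)
        also have "\<dots> = (\<rho> (a [^] k) * \<rho> b * e) * q" using comm[OF bA(1) pow] by simp
        also have "\<dots> = \<rho> (a [^] k) * (\<rho> b * (e * q))" using a bA by (simp add: mat_assoc)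
        finally show ?thesis using q(3) by simp
      qed
      from commute_pow[OF _ this] have "\<rho> b * w = mat_sum n {..<ord a} (\<lambda>k. c ^ k \<cdot>\<^sub>m (\<rho> (a [^] k) * (c' \<cdot>\<^sub>m q)))"
        using bA by (simp add: c')
      also have "\<dots> = c' \<cdot>\<^sub>m w"
        using a unfolding w_def
        by (subst mat_sum_smult) (auto intro!: mat_sum_cong simp: mult_smult_distrib[of _ n n _ n] smult_smult_mat mult.commute)
      finally show ?thesis by blast
    qed
    ultimately show ?case
      using cd unfolding w_def[symmetric] by (intro bexI[of _ w]) (auto simp: w_def)
  qed
  then obtain q where q: "q \<in> carrier_mat n n" "q \<noteq> 0\<^sub>m n n" "e * q = q"
    and eig: "\<forall>a\<in>A. \<exists>c. \<rho> a * q = c \<cdot>\<^sub>m q"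
    using finite_subset[OF A.subset finite_carrier] by blast
  from bchoice[OF eig] obtain \<mu> where "\<forall>a\<in>A. \<rho> a * q = \<mu> a \<cdot>\<^sub>m q" by blast
  then show thesis using that q by blast
qed


text \<open>
  The projection of the image of \<open>e\<close> onto its subspace on which \<open>A\<close> acts through the linear
  character \<open>\<mu>\<close>.
\<close>
definition weight_projection :: "'a set \<Rightarrow> ('a \<Rightarrow> complex) \<Rightarrow> complex mat \<Rightarrow> complex mat" where
  "weight_projection A \<mu> e = mat_sum n A (\<lambda>a. (inverse (\<mu> a) / of_nat (card A)) \<cdot>\<^sub>m (\<rho> a * e))"

text \<open>
  The matrix \<open>q\<close> witnesses that the weight \<open>\<mu>\<close> occurs; this makes \<open>\<mu>\<close> multiplicative and
  the projection nonzero.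
\<close>
lemma weight_block:
  assumes e: "block e" and A: "subgroup A G" and stab: "A \<subseteq> block_stabilizer e"
    and normal: "\<And>u a. u \<in> block_stabilizer e \<Longrightarrow> a \<in> A \<Longrightarrow> u \<otimes> a \<otimes> inv u \<in> A"
    and q: "q \<in> carrier_mat n n" "q \<noteq> 0\<^sub>m n n" "e * q = q"
    and \<mu>: "\<And>a. a \<in> A \<Longrightarrow> \<rho> a * q = \<mu> a \<cdot>\<^sub>m q"
  defines "f \<equiv> weight_projection A \<mu> e"
  shows "block f" "e * f = f" "f * e = f" "block_stabilizer f \<subseteq> block_stabilizer e"
    "\<And>a. a \<in> A \<Longrightarrow> \<rho> a * f = \<mu> a \<cdot>\<^sub>m f"
proof -
  interpret A: subgroup A G by (rule A)
  interpret U: subgroup "block_stabilizer e" G using e by (intro block_stabilizer_subgroup) simp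
  note [simp] = block_carrier[OF e] q(1)
  have finA: "finite A" using A.subset finite_carrier finite_subset by blast
  have cardA: "of_nat (card A) \<noteq> (0 :: complex)" using finA A.one_closed by (metis card_eq_0_iff empty_iff of_nat_eq_0_iff)
  have fc [simp]: "f \<in> carrier_mat n n" by (simp add: f_def weight_projection_def)
  have \<mu>_mult: "\<mu> (a \<otimes> b) = \<mu> a * \<mu> b" if "a \<in> A" "b \<in> A" for a b
  proof (rule smult_mat_cancel[OF _ q(1,2)])
    have "\<rho> (a \<otimes> b) * q = \<rho> a * (\<rho> b * q)" using that by (simp add: rho_mult mat_assoc)
    also have "\<dots> = (\<mu> a * \<mu> b) \<cdot>\<^sub>m q"
      using that by (simp add: \<mu> mult_smult_distrib[of _ n n _ n] smult_smult_mat mult.commute)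
    finally show "\<mu> (a \<otimes> b) \<cdot>\<^sub>m q = (\<mu> a * \<mu> b) \<cdot>\<^sub>m q" using that by (simp add: \<mu>)
  qed
  have \<mu>_one: "\<mu> \<one> = 1"
    using \<mu>[OF A.one_closed] by (intro smult_mat_cancel[OF _ q(1,2)]) (simp add: rho_one)
  have \<mu>_inv: "\<mu> (inv a) = inverse (\<mu> a)" if "a \<in> A" for a
    using \<mu>_mult[OF that A.m_inv_closed[OF that]] that by (simp add: \<mu>_one inverse_unique)
  have \<mu>_nonzero: "\<mu> a \<noteq> 0" if "a \<in> A" for a
    using \<mu>_mult[OF that A.m_inv_closed[OF that]] that by (auto simp: \<mu>_one)
  have ecomm: "e * \<rho> u = \<rho> u * e" if "u \<in> block_stabilizer e" for u
    using that unfolding block_stabilizer_def by blast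
  have mult_left: "Y * f = mat_sum n A (\<lambda>a. (inverse (\<mu> a) / of_nat (card A)) \<cdot>\<^sub>m (Y * (\<rho> a * e)))"
    if "Y \<in> carrier_mat n n" for Y
    using that unfolding f_def weight_projection_def
    by (subst mat_sum_mult_left) (auto intro!: mat_sum_cong simp: mult_smult_distrib[of _ n n _ n])
  have mult_right: "f * Y = mat_sum n A (\<lambda>a. (inverse (\<mu> a) / of_nat (card A)) \<cdot>\<^sub>m (\<rho> a * e * Y))"
    if "Y \<in> carrier_mat n n" for Y
    using that unfolding f_def weight_projection_def
    by (subst mat_sum_mult_right) (auto intro!: mat_sum_cong simp: mult_smult_assoc_mat[of _ n n _ n])
  show fe: "f * e = f"
    unfolding mult_right[OF block_carrier[OF e]] unfolding f_def weight_projection_def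
    by (intro mat_sum_cong) (simp add: mat_assoc block_idem[OF e])
  have "e * (\<rho> a * e) = \<rho> a * e" if "a \<in> A" for a
  proof -
    have "e * (\<rho> a * e) = (\<rho> a * e) * e" using that stab ecomm[of a] by (simp add: subset_iff flip: mat_assoc)
    then show ?thesis using that by (simp add: mat_assoc block_idem[OF e])
  qed
  then show ef: "e * f = f"
    unfolding mult_left[OF block_carrier[OF e]] unfolding f_def weight_projection_def
    by (intro mat_sum_cong) simp
  show left: "\<rho> b * f = \<mu> b \<cdot>\<^sub>m f" if b: "b \<in> A" for b
  proof -
    have bij: "bij_betw (\<lambda>a. b \<otimes> a) A A"
      using b by (intro bij_betw_byWitness[of _ "\<lambda>a. inv b \<otimes> a"]) (auto simp flip: m_assoc)
    have "\<rho> b * f = mat_sum n A (\<lambda>a. (\<mu> b * inverse (\<mu> (b \<otimes> a)) / of_nat (card A)) \<cdot>\<^sub>m (\<rho> (b \<otimes> a) * e))"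
      unfolding mult_left[OF rho_carrier[OF A.mem_carrier[OF b]]]
      using b \<mu>_nonzero[OF b] by (intro mat_sum_cong) (simp add: \<mu>_mult rho_mult mat_assoc field_simps)
    also have "\<dots> = mat_sum n A (\<lambda>a. (\<mu> b * inverse (\<mu> a) / of_nat (card A)) \<cdot>\<^sub>m (\<rho> a * e))"
      by (rule mat_sum_reindex[OF bij])
    also have "\<dots> = \<mu> b \<cdot>\<^sub>m f"
      unfolding f_def weight_projection_def
      by (subst mat_sum_smult) (auto intro!: mat_sum_cong simp: smult_smult_mat field_simps)
    finally show ?thesis .
  qed
  have right: "f * \<rho> b = \<mu> b \<cdot>\<^sub>m f" if b: "b \<in> A" for b
  proof -
    have bij: "bij_betw (\<lambda>a. a \<otimes> b) A A"
      using b by (intro bij_betw_byWitness[of _ "\<lambda>a. a \<otimes> inv b"]) (auto simp: m_assoc)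
    have move: "\<rho> a * e * \<rho> b = \<rho> (a \<otimes> b) * e" if a: "a \<in> A" for a
    proof -
      have "\<rho> a * e * \<rho> b = \<rho> a * (e * \<rho> b)" using a b by (simp add: mat_assoc)
      also have "e * \<rho> b = \<rho> b * e" using b stab by (intro ecomm) blast
      finally show ?thesis using a b by (simp add: rho_mult mat_assoc)
    qed
    have "f * \<rho> b = mat_sum n A (\<lambda>a. (\<mu> b * inverse (\<mu> (a \<otimes> b)) / of_nat (card A)) \<cdot>\<^sub>m (\<rho> (a \<otimes> b) * e))"
      unfolding mult_right[OF rho_carrier[OF A.mem_carrier[OF b]]]
      using b \<mu>_nonzero[OF b] move by (intro mat_sum_cong) (simp add: \<mu>_mult field_simps)
    also have "\<dots> = mat_sum n A (\<lambda>a. (\<mu> b * inverse (\<mu> a) / of_nat (card A)) \<cdot>\<^sub>m (\<rho> a * e))"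
      by (rule mat_sum_reindex[OF bij])
    also have "\<dots> = \<mu> b \<cdot>\<^sub>m f"
      unfolding f_def weight_projection_def
      by (subst mat_sum_smult) (auto intro!: mat_sum_cong simp: smult_smult_mat field_simps)
    finally show ?thesis .
  qed
  have "f * f = mat_sum n A (\<lambda>a. (1 / of_nat (card A)) \<cdot>\<^sub>m f)"
    unfolding mult_right[OF fc]
    by (intro mat_sum_cong) (simp add: mat_assoc ef left smult_smult_mat \<mu>_nonzero)
  also have "\<dots> = f"
    using cardA by (subst mat_sum_const) (auto simp: smult_smult_mat)
  finally have ff: "f * f = f" .
  have "f * q = mat_sum n A (\<lambda>a. (1 / of_nat (card A)) \<cdot>\<^sub>m q)"
    unfolding mult_right[OF q(1)]
    by (intro mat_sum_cong) (simp add: mat_assoc q(3) \<mu> smult_smult_mat \<mu>_nonzero)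
  also have "\<dots> = q"
    using cardA by (subst mat_sum_const) (auto simp: smult_smult_mat)
  finally have f0: "f \<noteq> 0\<^sub>m n n" using q(2) left_mult_zero_mat[OF q(1), of n] by auto
  have outside: "f * \<rho> g * f = 0\<^sub>m n n" if g: "g \<in> carrier G" "g \<notin> block_stabilizer e" for g
  proof -
    have "f * \<rho> g * f = (f * e) * \<rho> g * (e * f)" by (simp add: ef fe)
    also have "\<dots> = f * (e * \<rho> g * e) * f" using g by (simp add: mat_assoc)
    also have "\<dots> = 0\<^sub>m n n"
      using block_compress_outside[OF e g] by (simp add: right_mult_zero_mat[of _ n n] left_mult_zero_mat[of _ n n])
    finally show ?thesis .
  qed
  \<comment> \<open>An element of the stabilizer either preserves the weight or moves it to a different one,
    and different weight spaces are killed by each other's projections.\<close>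
  have inside: "f * \<rho> u = \<rho> u * f" if u: "u \<in> block_stabilizer e" and nz: "f * \<rho> u * f \<noteq> 0\<^sub>m n n" for u
  proof -
    have uG: "u \<in> carrier G" using u U.subset by blast
    have conj: "inv u \<otimes> a \<otimes> u \<in> A" if "a \<in> A" for a
      using normal[OF U.m_inv_closed[OF u] that] uG by simp
    have same: "\<mu> a = \<mu> (inv u \<otimes> a \<otimes> u)" if a: "a \<in> A" for a
    proof (rule smult_mat_cancel[OF _ _ nz])
      have "\<mu> a \<cdot>\<^sub>m (f * \<rho> u * f) = f * \<rho> a * \<rho> u * f"
        using a uG by (simp add: right mult_smult_assoc_mat[of _ n n _ n])
      also have "\<dots> = f * \<rho> u * (\<rho> (inv u \<otimes> a \<otimes> u) * f)"
      proof -
        have "\<rho> a * \<rho> u = \<rho> u * \<rho> (inv u \<otimes> a \<otimes> u)"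
        proof -
          have "u \<otimes> (inv u \<otimes> a \<otimes> u) = a \<otimes> u" using a uG by (simp flip: m_assoc)
          then show ?thesis using a uG by (metis A.mem_carrier conj rho_mult)
        qed
        then have "f * (\<rho> a * \<rho> u) * f = f * (\<rho> u * \<rho> (inv u \<otimes> a \<otimes> u)) * f" by simp
        then show ?thesis using a uG by (simp add: mat_assoc)
      qed
      also have "\<dots> = \<mu> (inv u \<otimes> a \<otimes> u) \<cdot>\<^sub>m (f * \<rho> u * f)"
        using left[OF conj[OF a]] uG by (simp add: mult_smult_distrib[of _ n n _ n])
      finally show "\<mu> a \<cdot>\<^sub>m (f * \<rho> u * f) = \<mu> (inv u \<otimes> a \<otimes> u) \<cdot>\<^sub>m (f * \<rho> u * f)" .
      show "f * \<rho> u * f \<in> carrier_mat n n" using uG by simp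
    qed
    have bij: "bij_betw (\<lambda>a. inv u \<otimes> a \<otimes> u) A A"
    proof (rule bij_betw_byWitness[of _ "\<lambda>a. u \<otimes> a \<otimes> inv u"])
      have cancel: "inv u \<otimes> (u \<otimes> v) = v" "u \<otimes> (inv u \<otimes> v) = v" if "v \<in> carrier G" for v
        using that uG by (simp_all flip: m_assoc)
      show "\<forall>a\<in>A. u \<otimes> (inv u \<otimes> a \<otimes> u) \<otimes> inv u = a" "\<forall>a\<in>A. inv u \<otimes> (u \<otimes> a \<otimes> inv u) \<otimes> u = a"
        using uG by (simp_all add: m_assoc cancel)
    qed (use conj normal u in auto)
    have "\<rho> u * f = mat_sum n A (\<lambda>a. (inverse (\<mu> a) / of_nat (card A)) \<cdot>\<^sub>m (\<rho> u * (\<rho> a * e)))"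
      using uG by (intro mult_left) simp
    also have "\<dots> = mat_sum n A (\<lambda>a. (inverse (\<mu> (inv u \<otimes> a \<otimes> u)) / of_nat (card A)) \<cdot>\<^sub>m (\<rho> u * (\<rho> (inv u \<otimes> a \<otimes> u) * e)))"
      using mat_sum_reindex[OF bij, symmetric] .
    also have "\<dots> = mat_sum n A (\<lambda>a. (inverse (\<mu> a) / of_nat (card A)) \<cdot>\<^sub>m (\<rho> a * e * \<rho> u))"
    proof (rule mat_sum_cong)
      fix a assume a: "a \<in> A"
      have "u \<otimes> (inv u \<otimes> a \<otimes> u) = a \<otimes> u" using a uG by (simp flip: m_assoc)
      then have "\<rho> u * \<rho> (inv u \<otimes> a \<otimes> u) = \<rho> a * \<rho> u" using a uG by (metis A.mem_carrier conj rho_mult)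
      then have "\<rho> u * (\<rho> (inv u \<otimes> a \<otimes> u) * e) = \<rho> a * \<rho> u * e"
        using a uG by (simp flip: mat_assoc)
      also have "\<dots> = \<rho> a * e * \<rho> u" using a uG ecomm[OF u] by (simp add: mat_assoc)
      finally show "(inverse (\<mu> (inv u \<otimes> a \<otimes> u)) / of_nat (card A)) \<cdot>\<^sub>m (\<rho> u * (\<rho> (inv u \<otimes> a \<otimes> u) * e))
          = (inverse (\<mu> a) / of_nat (card A)) \<cdot>\<^sub>m (\<rho> a * e * \<rho> u)"
        using same[OF a] by simp
    qed
    also have "\<dots> = f * \<rho> u" using uG by (intro mult_right[symmetric]) simp
    finally show ?thesis by simp
  qed
  show "block f"
    using f0 ff inside outside unfolding block_def by auto
  show "block_stabilizer f \<subseteq> block_stabilizer e"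
  proof (rule subsetI, rule ccontr)
    fix g assume g: "g \<in> block_stabilizer f" "g \<notin> block_stabilizer e"
    then have gG: "g \<in> carrier G" and comm: "f * \<rho> g = \<rho> g * f"
      unfolding block_stabilizer_def by blast+
    have "\<rho> g * f = \<rho> g * f * f" using gG by (simp add: mat_assoc ff)
    also have "\<dots> = f * \<rho> g * f" by (simp only: comm)
    also have "\<dots> = 0\<^sub>m n n" by (rule outside[OF gG g(2)])
    finally have "\<rho> (inv g) * (\<rho> g * f) = 0\<^sub>m n n" using gG by (simp add: right_mult_zero_mat[of _ n n])
    then have "f = 0\<^sub>m n n" using gG by (simp add: rho_inv flip: mat_assoc)
    then show False using f0 by simp
  qed
qed

text \<open>
  A weight projection is a block below \<open>e\<close>. As the stabilizer of \<open>e\<close> is minimal, both blocks have the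
  same stabilizer, so the weight projection commutes with \<open>N \<inter> block_stabilizer e\<close>, and irreducibility
  makes it equal to \<open>e\<close>.
\<close>
lemma minimal_block_abelian_scalar:
  assumes e: "block e" and minimal: "\<And>f. block f \<Longrightarrow> card (block_stabilizer e) \<le> card (block_stabilizer f)"
    and span: "spanned_by N" and N: "N \<subseteq> carrier G"
    and A: "subgroup A G" and stab: "A \<subseteq> block_stabilizer e"
    and normal: "\<And>u a. u \<in> block_stabilizer e \<Longrightarrow> a \<in> A \<Longrightarrow> u \<otimes> a \<otimes> inv u \<in> A"
    and comm: "\<And>a b. a \<in> A \<Longrightarrow> b \<in> A \<Longrightarrow> \<rho> a * \<rho> b * e = \<rho> b * \<rho> a * e"
    and a: "a \<in> A"
  shows "\<exists>c. e * \<rho> a = c \<cdot>\<^sub>m e"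
proof -
  obtain q \<mu> where q: "q \<in> carrier_mat n n" "q \<noteq> 0\<^sub>m n n" "e * q = q"
    and \<mu>: "\<And>a. a \<in> A \<Longrightarrow> \<rho> a * q = \<mu> a \<cdot>\<^sub>m q"
    using common_eigenvector[OF e A comm stab] by blast
  define f where "f = weight_projection A \<mu> e"
  have f: "block f" "e * f = f" "f * e = f" "block_stabilizer f \<subseteq> block_stabilizer e"
    unfolding f_def by (rule weight_block[OF e A stab normal q \<mu>]; assumption)+
  have eigen: "\<rho> a * f = \<mu> a \<cdot>\<^sub>m f"
    unfolding f_def by (rule weight_block(5)[OF e A stab normal q \<mu> a]; assumption)
  have "finite (block_stabilizer e)" using block_stabilizer_subset finite_carrier finite_subset by blast
  then have stab_eq: "block_stabilizer f = block_stabilizer e"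
    using f(4) minimal[OF f(1)] by (intro card_seteq) auto
  have "f = e"
  proof (rule block_minimal[OF span N e])
    fix x assume "x \<in> N \<inter> block_stabilizer e"
    then show "f * \<rho> x = \<rho> x * f" using stab_eq unfolding block_stabilizer_def by blast
  qed (use f block_nonzero[OF f(1)] block_idem[OF f(1)] in auto)
  moreover have "e * \<rho> a = \<rho> a * e" using a stab unfolding block_stabilizer_def by blast
  ultimately show ?thesis using eigen by auto
qed

end

section \<open>Characters that stay irreducible on the normal subgroup are monomial\<close>

lemma (in group) solvable_restrict_subgroup:
  assumes H: "subgroup H G" and solv: "solvable G"
  shows "solvable (G\<lparr>carrier := H\<rparr>)"
proof -
  have "group_hom (G\<lparr>carrier := H\<rparr>) G (\<lambda>x. x)"
    using subgroup_imp_group[OF H] subgroup.subset[OF H]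
    by (auto simp: group_hom_def group_hom_axioms_def hom_def is_group)
  then show ?thesis by (rule group_hom.inj_hom_imp_solvable) (use solv in auto)
qed

context matrix_representation begin

lemma block_one:
  assumes "n > 0"
  shows "block (1\<^sub>m n)"
proof -
  have "(1\<^sub>m n :: complex mat) $$ (0, 0) \<noteq> 0\<^sub>m n n $$ (0, 0)" using assms by simp
  then have "(1\<^sub>m n :: complex mat) \<noteq> 0\<^sub>m n n" by metis
  then show ?thesis by (simp add: block_def)
qed

text \<open>
  The step where solvability and the abelian Sylow subgroups enter. With \<open>M\<close> and \<open>Z\<close> as below, a
  proper inclusion \<open>Z \<subset> M\<close> would yield a normal subgroup \<open>A\<close> of the stabilizer that acts through commuting
  matrices without acting by scalars.
\<close>
lemma minimal_block_rank_one:
  assumes e: "block e" and minimal: "\<And>f. block f \<Longrightarrow> card (block_stabilizer e) \<le> card (block_stabilizer f)"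
    and span: "spanned_by N" and N: "N \<lhd> G" and solv: "solvable G"
    and sylow: "\<And>p S. sylow_subgroup (G\<lparr>carrier := N\<rparr>) p S \<Longrightarrow> comm_group (G\<lparr>carrier := S\<rparr>)"
    and Y: "Y \<in> carrier_mat n n"
  shows "\<exists>c. e * Y * e = c \<cdot>\<^sub>m e"
proof -
  interpret N: normal N G by (rule N)
  note [simp] = block_carrier[OF e]
  define U where "U = block_stabilizer e"
  have U: "subgroup U G" unfolding U_def by (intro block_stabilizer_subgroup) simp
  interpret U: subgroup U G by (rule U)
  let ?U = "G\<lparr>carrier := U\<rparr>"
  interpret GU: group ?U by (rule subgroup_imp_group[OF U])
  have ecomm: "e * \<rho> u = \<rho> u * e" if "u \<in> U" for u
    using that unfolding U_def block_stabilizer_def by blast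
  define M where "M = N \<inter> U"
  define Z where "Z = {m \<in> M. \<exists>c. e * \<rho> m = c \<cdot>\<^sub>m e}"
  have M: "subgroup M G" unfolding M_def by (rule subgroups_Inter_pair[OF N.subgroup_axioms U])
  have M_normal: "M \<lhd> ?U"
    unfolding GU.normal_inv_iff
  proof (intro conjI ballI)
    show "subgroup M ?U" by (rule subgroup_incl[OF M U]) (simp add: M_def)
    fix u m assume "u \<in> carrier ?U" "m \<in> M"
    then show "u \<otimes>\<^bsub>?U\<^esub> m \<otimes>\<^bsub>?U\<^esub> inv\<^bsub>?U\<^esub> u \<in> M"
      using N.inv_op_closed2[of u m] U by (auto simp: M_def)
  qed
  have Z_subgroup: "subgroup Z G"
  proof
    show "Z \<subseteq> carrier G" using U.subset by (auto simp: Z_def M_def)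
    show "\<one> \<in> Z"
      using subgroup.one_closed[OF M] by (auto simp: Z_def rho_one intro!: exI[of _ 1] eq_matI)
    fix x assume x: "x \<in> Z"
    then obtain c where xM: "x \<in> M" "x \<in> U" "x \<in> carrier G" and c: "e * \<rho> x = c \<cdot>\<^sub>m e"
      using U.subset by (auto simp: Z_def M_def)
    show "x \<otimes> y \<in> Z" if y: "y \<in> Z" for y
    proof -
      obtain d where yM: "y \<in> M" "y \<in> U" "y \<in> carrier G" and d: "e * \<rho> y = d \<cdot>\<^sub>m e"
        using y U.subset by (auto simp: Z_def M_def)
      have "e * \<rho> (x \<otimes> y) = (e * \<rho> x) * \<rho> y" using xM yM by (simp add: rho_mult mat_assoc)
      also have "\<dots> = (c * d) \<cdot>\<^sub>m e" using yM by (simp add: c d mult_smult_assoc_mat[of _ n n _ n] smult_smult_mat)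
      finally show ?thesis using subgroup.m_closed[OF M xM(1) yM(1)] by (auto simp: Z_def)
    qed
    have "e = (e * \<rho> x) * \<rho> (inv x)" using xM by (simp add: mat_assoc rho_inv)
    also have "\<dots> = c \<cdot>\<^sub>m (e * \<rho> (inv x))" using xM by (simp add: c mult_smult_assoc_mat[of _ n n _ n])
    finally have eq: "e = c \<cdot>\<^sub>m (e * \<rho> (inv x))" .
    have "c \<noteq> 0"
    proof
      assume "c = 0"
      then have "e = 0\<^sub>m n n" using eq zero_smult_mat[of "e * \<rho> (inv x)" n] xM by simp
      then show False using block_nonzero[OF e] by simp
    qed
    then have "inverse c \<cdot>\<^sub>m e = e * \<rho> (inv x)"
      using arg_cong[OF eq, of "\<lambda>A. inverse c \<cdot>\<^sub>m A"] by (simp add: smult_smult_mat)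
    then show "inv x \<in> Z" using subgroup.m_inv_closed[OF M xM(1)] by (auto simp: Z_def intro: sym)
  qed
  have Z_normal: "Z \<lhd> ?U"
    unfolding GU.normal_inv_iff
  proof (intro conjI ballI)
    show "subgroup Z ?U" by (rule subgroup_incl[OF Z_subgroup U]) (auto simp: Z_def M_def)
    fix u m assume u: "u \<in> carrier ?U" and m: "m \<in> Z"
    then obtain c where m': "m \<in> M" "m \<in> carrier G" and c: "e * \<rho> m = c \<cdot>\<^sub>m e" and u': "u \<in> U" "u \<in> carrier G"
      using U.subset by (auto simp: Z_def M_def)
    have "e * \<rho> (u \<otimes> m \<otimes> inv u) = (e * \<rho> u) * \<rho> m * \<rho> (inv u)"
      using m' u' by (simp add: rho_mult mat_assoc)
    also have "\<dots> = \<rho> u * (e * \<rho> m) * \<rho> (inv u)"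
      using m' u' ecomm by (simp add: mat_assoc)
    also have "\<dots> = c \<cdot>\<^sub>m (\<rho> u * e * \<rho> (inv u))"
      using u' by (simp add: c mult_smult_assoc_mat[of _ n n _ n] mult_smult_distrib[of _ n n _ n])
    also have "\<rho> u * e * \<rho> (inv u) = e"
      using u' by (simp add: mat_assoc rho_inv flip: ecomm)
    finally show "u \<otimes>\<^bsub>?U\<^esub> m \<otimes>\<^bsub>?U\<^esub> inv\<^bsub>?U\<^esub> u \<in> Z"
      using GU.normal_inv_iff[of M] M_normal m' u' U by (auto simp: Z_def)
  qed
  have "Z = M"
  proof (rule ccontr)
    assume "Z \<noteq> M"
    have finU: "finite (carrier ?U)" using finite_subset[OF U.subset finite_carrier] by simp
    obtain A p where A: "A \<lhd> ?U" "A \<subseteq> M" "\<not> A \<subseteq> Z" and p: "Factorial_Ring.prime p"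
      and derived: "derived ?U A \<subseteq> Z" and exponent: "\<And>a. a \<in> A \<Longrightarrow> a [^]\<^bsub>?U\<^esub> (p :: nat) \<in> Z"
      using GU.exists_elementary_abelian_section[OF finU solvable_restrict_subgroup[OF U solv] M_normal Z_normal _ \<open>Z \<noteq> M\<close>]
      by (auto simp: Z_def)
    have AU: "subgroup A ?U" using A(1) by (simp add: normal_imp_subgroup)
    have AG: "subgroup A G" by (rule incl_subgroup[OF U AU])
    obtain P k where P: "subgroup P ?U" "P \<subseteq> A" "card P = p ^ k"
      and factor: "\<And>a. a \<in> A \<Longrightarrow> \<exists>z\<in>Z. \<exists>x\<in>P. a = z \<otimes>\<^bsub>?U\<^esub> x"
      using GU.factor_through_sylow[OF finU Z_normal AU derived p exponent] by blast
    have PG: "subgroup P G" by (rule incl_subgroup[OF U P(1)])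
    have PN: "P \<subseteq> N" using P(2) A(2) by (auto simp: M_def)
    have abelian: "x \<otimes> y = y \<otimes> x" if "x \<in> P" "y \<in> P" for x y
    proof -
      interpret GN: group "G\<lparr>carrier := N\<rparr>" by (rule subgroup_imp_group[OF N.subgroup_axioms])
      have "finite (carrier (G\<lparr>carrier := N\<rparr>))" using finite_subset[OF N.subset finite_carrier] by simp
      from GN.p_subgroup_commutes[OF this _ p subgroup_incl[OF PG N.subgroup_axioms PN] P(3) that]
      show ?thesis using sylow by simp
    qed
    have comm: "\<rho> a * \<rho> b * e = \<rho> b * \<rho> a * e" if ab: "a \<in> A" "b \<in> A" for a b
    proof -
      \<comment> \<open>Up to scalars, the elements of \<open>A\<close> act on the block like elements of \<open>P\<close>.\<close>
      have form: "\<exists>c x. x \<in> P \<and> e * \<rho> a = c \<cdot>\<^sub>m (e * \<rho> x)" if a: "a \<in> A" for a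
      proof -
        obtain z x where zx: "z \<in> Z" "x \<in> P" "a = z \<otimes> x" using factor[OF a] by auto
        then obtain c where c: "e * \<rho> z = c \<cdot>\<^sub>m e" by (auto simp: Z_def)
        have in_carrier: "z \<in> carrier G" "x \<in> carrier G"
          using zx subgroup.mem_carrier[OF Z_subgroup] subgroup.mem_carrier[OF PG] by auto
        have "e * \<rho> a = (e * \<rho> z) * \<rho> x" using zx in_carrier by (simp add: rho_mult mat_assoc)
        also have "\<dots> = c \<cdot>\<^sub>m (e * \<rho> x)" using in_carrier by (simp add: c mult_smult_assoc_mat[of _ n n _ n])
        finally show ?thesis using zx by blast
      qed
      obtain c x where x: "x \<in> P" "e * \<rho> a = c \<cdot>\<^sub>m (e * \<rho> x)" using form[OF ab(1)] by blast
      obtain d y where y: "y \<in> P" "e * \<rho> b = d \<cdot>\<^sub>m (e * \<rho> y)" using form[OF ab(2)] by blast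
      have mem: "a \<in> U" "b \<in> U" "x \<in> U" "y \<in> U" "a \<in> carrier G" "b \<in> carrier G" "x \<in> carrier G" "y \<in> carrier G"
        using ab x y A(2) P(2) U.subset by (auto simp: M_def)
      have product: "\<rho> g * \<rho> h * e = (s * t) \<cdot>\<^sub>m (e * \<rho> (v \<otimes> w))"
        if "e * \<rho> g = s \<cdot>\<^sub>m (e * \<rho> v)" "e * \<rho> h = t \<cdot>\<^sub>m (e * \<rho> w)" "g \<in> U" "h \<in> U" "v \<in> U" "w \<in> U" for g h s t v w
      proof -
        have C: "g \<in> carrier G" "h \<in> carrier G" "v \<in> carrier G" "w \<in> carrier G" using that U.subset by auto
        have "\<rho> g * \<rho> h * e = \<rho> g * (e * \<rho> h)" using C ecomm[OF that(4)] by (simp add: mat_assoc)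
        also have "\<dots> = t \<cdot>\<^sub>m ((\<rho> g * e) * \<rho> w)"
          using C that(2) by (simp add: mult_smult_distrib[of _ n n _ n] mat_assoc)
        also have "(\<rho> g * e) * \<rho> w = s \<cdot>\<^sub>m (e * \<rho> v * \<rho> w)"
          using C that(1) by (simp add: mult_smult_assoc_mat[of _ n n _ n] flip: ecomm[OF that(3)])
        finally show ?thesis using C by (simp add: smult_smult_mat rho_mult mat_assoc mult.commute)
      qed
      have "\<rho> a * \<rho> b * e = (c * d) \<cdot>\<^sub>m (e * \<rho> (x \<otimes> y))" using x y mem by (intro product)
      moreover have "\<rho> b * \<rho> a * e = (d * c) \<cdot>\<^sub>m (e * \<rho> (y \<otimes> x))" using x y mem by (intro product)
      ultimately show ?thesis using abelian[OF x(1) y(1)] by (simp add: mult.commute)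
    qed
    have "A \<subseteq> Z"
    proof
      fix a assume a: "a \<in> A"
      have "\<exists>c. e * \<rho> a = c \<cdot>\<^sub>m e"
      proof (rule minimal_block_abelian_scalar[OF e minimal span N.subset AG _ _ comm a])
        show "A \<subseteq> block_stabilizer e" using A(2) by (auto simp: M_def U_def)
        fix u a assume "u \<in> block_stabilizer e" "a \<in> A"
        then show "u \<otimes> a \<otimes> inv u \<in> A"
          using GU.normal_inv_iff[of A] A(1) U by (auto simp: U_def)
      qed
      then show "a \<in> Z" using a A(2) by (auto simp: Z_def)
    qed
    then show False using A(3) by simp
  qed
  then have scalar: "\<exists>c. e * \<rho> x = c \<cdot>\<^sub>m e" if "x \<in> N \<inter> block_stabilizer e" for x
    using that by (auto simp: Z_def M_def U_def)
  obtain c where c: "e * Y * e = mat_sum n (N \<inter> block_stabilizer e) (\<lambda>x. c x \<cdot>\<^sub>m (e * \<rho> x))"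
    using block_compression[OF span N.subset e Y] .
  obtain d where d: "\<forall>x\<in>N \<inter> block_stabilizer e. e * \<rho> x = d x \<cdot>\<^sub>m e"
    using bchoice[of "N \<inter> block_stabilizer e" "\<lambda>x c. e * \<rho> x = c \<cdot>\<^sub>m e"] scalar by blast
  have "e * Y * e = mat_sum n (N \<inter> block_stabilizer e) (\<lambda>x. (c x * d x) \<cdot>\<^sub>m e)"
    unfolding c using d by (intro mat_sum_cong) (simp add: smult_smult_mat)
  then show ?thesis by (auto simp: mat_sum_scaled_const)
qed

theorem monomial_if_normal_subgroup_spans:
  assumes sc: "scalar_commutant G n \<rho>" and span: "spanned_by N" and N: "N \<lhd> G" and solv: "solvable G"
    and sylow: "\<And>p S. sylow_subgroup (G\<lparr>carrier := N\<rparr>) p S \<Longrightarrow> comm_group (G\<lparr>carrier := S\<rparr>)"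
  obtains U \<theta> where "subgroup U G" "linear_character (G\<lparr>carrier := U\<rparr>) \<theta>" "char_of_rep G \<rho> = induced G U \<theta>"
proof -
  have "block (1\<^sub>m n)" using sc by (intro block_one) (simp add: scalar_commutant_def)
  then obtain e where e: "block e" and minimal: "\<And>f. block f \<Longrightarrow> card (block_stabilizer e) \<le> card (block_stabilizer f)"
    using ex_has_least_nat[of block _ "\<lambda>e. card (block_stabilizer e)"] by blast
  let ?U = "block_stabilizer e" and ?\<theta> = "\<lambda>u\<in>block_stabilizer e. mat_trace (e * \<rho> u)"
  show thesis
  proof (rule that)
    show "subgroup ?U G" using e by (intro block_stabilizer_subgroup) simp
    show "linear_character (G\<lparr>carrier := ?U\<rparr>) ?\<theta>"
      using minimal_block_rank_one[OF e minimal span N solv sylow] by (intro rank_one_block_linear_character[OF e])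
    show "char_of_rep G \<rho> = induced G ?U ?\<theta>"
      by (auto simp: char_of_rep_def induced_def trace_as_induced[OF sc e] intro!: restrict_ext arg_cong[where f = "\<lambda>s. s / _"] sum.cong)
  qed
qed

end

section \<open>Transitivity of induction\<close>

text \<open>
  In the double sum over \<open>x \<in> G\<close> and \<open>y \<in> H\<close> the conjugating element is \<open>y \<otimes> x\<close>, and for each fixed \<open>y\<close>
  it runs through \<open>G\<close> once. The condition that the inner conjugate lies in \<open>H\<close> is implied by the outer
  one, as \<open>U \<subseteq> H\<close>.
\<close>
lemma (in group) induced_transitive:
  assumes fin: "finite (carrier G)" and H: "subgroup H G" and U: "subgroup U (G\<lparr>carrier := H\<rparr>)"
  shows "induced G H (induced (G\<lparr>carrier := H\<rparr>) U \<theta>) = induced G U \<theta>"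
proof -
  interpret H: subgroup H G by (rule H)
  have UG: "subgroup U G" and UH: "U \<subseteq> H"
    using incl_subgroup[OF H U] subgroup.subset[OF U] by auto
  have cardH: "card H \<noteq> 0"
    using finite_subset[OF H.subset fin] H.one_closed by (metis card_eq_0_iff empty_iff)
  let ?F = "\<lambda>y. if y \<in> U then \<theta> y else 0"
  have sum_eq: "(\<Sum>x\<in>carrier G. if x \<otimes> g \<otimes> inv x \<in> H then induced (G\<lparr>carrier := H\<rparr>) U \<theta> (x \<otimes> g \<otimes> inv x) else 0)
      = of_nat (card H) * (\<Sum>x\<in>carrier G. ?F (x \<otimes> g \<otimes> inv x)) / of_nat (card U)"
    if g: "g \<in> carrier G" for g
  proof -
    have inner: "(if x \<otimes> g \<otimes> inv x \<in> H then induced (G\<lparr>carrier := H\<rparr>) U \<theta> (x \<otimes> g \<otimes> inv x) else 0)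
        = (\<Sum>y\<in>H. ?F ((y \<otimes> x) \<otimes> g \<otimes> inv (y \<otimes> x))) / of_nat (card U)" if x: "x \<in> carrier G" for x
    proof -
      have conj: "(y \<otimes> x) \<otimes> g \<otimes> inv (y \<otimes> x) = y \<otimes> (x \<otimes> g \<otimes> inv x) \<otimes> inv y" if "y \<in> H" for y
        using that x g by (simp add: inv_mult_group m_assoc)
      show ?thesis
      proof (cases "x \<otimes> g \<otimes> inv x \<in> H")
        case True
        then show ?thesis using H by (simp add: induced_def conj cong: if_cong)
      next
        case False
        have "y \<otimes> (x \<otimes> g \<otimes> inv x) \<otimes> inv y \<notin> U" if y: "y \<in> H" for y
        proof
          assume "y \<otimes> (x \<otimes> g \<otimes> inv x) \<otimes> inv y \<in> U"
          then have "inv y \<otimes> (y \<otimes> (x \<otimes> g \<otimes> inv x) \<otimes> inv y) \<otimes> y \<in> H" using UH y by blast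
          moreover have "inv y \<otimes> (y \<otimes> (x \<otimes> g \<otimes> inv x) \<otimes> inv y) \<otimes> y = x \<otimes> g \<otimes> inv x"
          proof -
            have "inv y \<otimes> (y \<otimes> v) = v" if "v \<in> carrier G" for v
              using y that by (simp flip: m_assoc)
            then show ?thesis using x g y by (simp add: m_assoc)
          qed
          ultimately show False using False by simp
        qed
        then show ?thesis using False by (simp add: conj cong: if_cong)
      qed
    qed
    have "(\<Sum>x\<in>carrier G. if x \<otimes> g \<otimes> inv x \<in> H then induced (G\<lparr>carrier := H\<rparr>) U \<theta> (x \<otimes> g \<otimes> inv x) else 0)
        = (\<Sum>x\<in>carrier G. (\<Sum>y\<in>H. ?F ((y \<otimes> x) \<otimes> g \<otimes> inv (y \<otimes> x))) / of_nat (card U))"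
      by (intro sum.cong refl inner)
    also have "\<dots> = (\<Sum>y\<in>H. \<Sum>x\<in>carrier G. ?F ((y \<otimes> x) \<otimes> g \<otimes> inv (y \<otimes> x))) / of_nat (card U)"
      by (simp only: sum_divide_distrib[symmetric]) (subst sum.swap, rule refl)
    also have "\<dots> = (\<Sum>y\<in>H. \<Sum>x\<in>carrier G. ?F (x \<otimes> g \<otimes> inv x)) / of_nat (card U)"
      using sum.reindex_bij_betw[OF bij_betw_mult_left, of _ "\<lambda>x. ?F (x \<otimes> g \<otimes> inv x)"] by simp
    finally show ?thesis by simp
  qed
  show ?thesis
    unfolding induced_def[of G H] induced_def[of G U]
    using cardH by (intro restrict_ext) (simp add: sum_eq)
qed

section \<open>Relative almost monomial groups\<close>

lemma (in group) irreducible_restriction_imp_monomial: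
  assumes fin: "finite (carrier G)" and N: "N \<lhd> G" and solv: "solvable G"
    and sylow: "\<And>p S. sylow_subgroup (G\<lparr>carrier := N\<rparr>) p S \<Longrightarrow> comm_group (G\<lparr>carrier := S\<rparr>)"
    and \<psi>: "\<psi> \<in> Irr G" "restrict \<psi> N \<in> Irr (G\<lparr>carrier := N\<rparr>)"
  obtains U \<theta> where "subgroup U G" "linear_character (G\<lparr>carrier := U\<rparr>) \<theta>" "\<psi> = induced G U \<theta>"
proof -
  interpret N: normal N G by (rule N)
  let ?N = "G\<lparr>carrier := N\<rparr>"
  obtain n \<rho> where \<rho>: "irreducible_representation G n \<rho>" "\<psi> = char_of_rep G \<rho>" using \<psi>(1) by (auto simp: Irr_def)
  obtain m \<sigma> where \<sigma>: "irreducible_representation ?N m \<sigma>" "restrict \<psi> N = char_of_rep ?N \<sigma>" using \<psi>(2) by (auto simp: Irr_def)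
  interpret matrix_representation G n \<rho>
    using \<rho>(1) fin by unfold_locales (auto simp: irreducible_representation_def)
  have groupN: "group ?N" by (rule subgroup_imp_group[OF N.subgroup_axioms])
  have finN: "finite (carrier ?N)" using finite_subset[OF N.subset fin] by simp
  have "representation ?N n \<rho>"
    using representation N.subset by (auto simp: representation_def hom_def)
  then interpret \<rho>N: matrix_representation ?N n \<rho>
    using groupN finN by (simp add: matrix_representation_def matrix_representation_axioms_def)
  have \<sigma>rep: "matrix_representation ?N m \<sigma>"
    using \<sigma>(1) groupN finN by (simp add: matrix_representation_def matrix_representation_axioms_def irreducible_representation_def)
  have "mat_trace (\<rho> g) = mat_trace (\<sigma> g)" if "g \<in> carrier ?N" for g
    using fun_cong[OF \<sigma>(2), of g] that N.subset by (auto simp: \<rho>(2) char_of_rep_def)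
  then have sc: "scalar_commutant ?N n \<rho>"
    by (rule \<rho>N.same_character_imp_scalar_commutant[OF \<sigma>rep \<sigma>(1)])
  have span: "spanned_by N"
    unfolding spanned_by_def
  proof
    fix Y :: "complex mat" assume "Y \<in> carrier_mat n n"
    then obtain c where "Y = mat_sum n (carrier ?N) (\<lambda>x. c x \<cdot>\<^sub>m \<rho> x)"
      by (rule \<rho>N.scalar_commutant_imp_spanning[OF sc])
    then show "\<exists>c. Y = mat_sum n N (\<lambda>x. c x \<cdot>\<^sub>m \<rho> x)" by auto
  qed
  show thesis
  proof (rule monomial_if_normal_subgroup_spans[OF irreducible_imp_scalar_commutant[OF \<rho>(1)] span N solv])
    show "comm_group (G\<lparr>carrier := S\<rparr>)" if "sylow_subgroup ?N p S" for p S
      using sylow[OF that] .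
  qed (use that \<rho>(2) in simp)
qed

theorem theorem4p3:
  fixes G :: "('a, 'b) monoid_scheme" and N :: "'a set"
  assumes "group G" and "finite (carrier G)"
    and "N \<lhd> G"
    and "\<And>p P. sylow_subgroup (G\<lparr>carrier := N\<rparr>) p P \<Longrightarrow> comm_group (G\<lparr>carrier := P\<rparr>)"
    and "solvable G"
    and "relative_almost_monomial G N"
  shows "almost_monomial G"
  unfolding almost_monomial_def
proof (intro ballI impI)
  interpret group G by (rule assms(1))
  fix \<chi> \<phi> assume "\<chi> \<in> Irr G" "\<phi> \<in> Irr G" "\<chi> \<noteq> \<phi>"
  then obtain H \<psi> where H: "subgroup H G" "N \<subseteq> H" and \<psi>: "\<psi> \<in> Irr (G\<lparr>carrier := H\<rparr>)" "restrict \<psi> N \<in> Irr (G\<lparr>carrier := N\<rparr>)"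
    and separates: "\<chi> \<in> constituents G (induced G H \<psi>)" "\<phi> \<notin> constituents G (induced G H \<psi>)"
    using assms(6) unfolding relative_almost_monomial_def by blast
  let ?H = "G\<lparr>carrier := H\<rparr>"
  interpret H: group ?H by (rule subgroup_imp_group[OF H(1)])
  obtain U \<theta> where U: "subgroup U ?H" "linear_character (?H\<lparr>carrier := U\<rparr>) \<theta>" "\<psi> = induced ?H U \<theta>"
  proof (rule H.irreducible_restriction_imp_monomial)
    show "finite (carrier ?H)" using finite_subset[OF subgroup.subset[OF H(1)] assms(2)] by simp
    show "N \<lhd> ?H" using normal_restrict_supergroup[OF H(1) assms(3) H(2)] .
    show "solvable ?H" using solvable_restrict_subgroup[OF H(1) assms(5)] .
  qed (use assms(4) \<psi> in simp_all)
  have "induced G H \<psi> = induced G U \<theta>"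
    using induced_transitive[OF assms(2) H(1) U(1)] U(3) by simp
  then show "\<exists>H \<theta>. subgroup H G \<and> linear_character (G\<lparr>carrier := H\<rparr>) \<theta> \<and>
      \<chi> \<in> constituents G (induced G H \<theta>) \<and> \<phi> \<notin> constituents G (induced G H \<theta>)"
    using incl_subgroup[OF H(1) U(1)] U(2) separates by auto
qed

end
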